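(* Let $N\ge 2$ be an integer and let $B_1=\{x\in\mathbb{R}^N:|x|<1\}$. Suppose that: (i) $K:[0,1)\to(0,\infty)$ is continuous on $[0,1)$; (ii) $f:(0,\infty)\to(0,\infty)$ is nondecreasing and locally Lipschitz continuous on $(0,\infty)$; (iii) with $F(\tau)=\int_0^\tau f(s)\,ds$ for $\tau>0$, one has $\int^{\infty}\left(F(\tau)\right)^{-\frac{N-1}{2N-1}}d\tau=\infty$. Assume further that there exist a function $p\in\mathcal{P}_\infty$ (the class defined in the context) and two constants $c,d>0$ such that $$c\,p(1-r)\le K(r)\le d\,p(1-r)\quad\text{for all } r<1 \text{ close to } 1.$$ Let $H$ be the function associated with $f$ and $N$ that is defined in the context. If $\lim_{\tau\to\infty}H(\tau)$ exists, then the boundary blow-up problem $$\left\{\begin{aligned}&\operatorname{det}^{\frac{1}{N-1}}\left(\Delta z\,I-D^2z\right)=K(|x|)f(z)&&\text{in } B_1,\\ &z(x)\to\infty\ \text{ as } \operatorname{dist}(x,\partial B_1)\to 0\end{aligned}\right.$$ has infinitely many radial $(N-1)$-convex solutions.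
   Context: Here $\Delta z$ is the Laplacian of $z$, $D^2z$ its Hessian matrix, $I$ is the $N\times N$ identity matrix, and $\det^{\frac1{N-1}}(\cdot)$ is the $(N-1)$-th root of $\det(\cdot)$. A function $z$ of class $C^2$ is called $(N-1)$-convex if the matrix $\Delta z(x)\,I-D^2z(x)$ is positive definite at every point $x$ of its domain. A radial solution is a function $z\in C^2(B_1)$ of the form $z(x)=u(|x|)$ with $u\in C^2[0,1)$, $u'(0)=0$, with positive values (so that $f(z)$ is defined), satisfying the equation in $B_1$ and the boundary blow-up condition. The condition $\int^\infty(\cdots)\,d\tau=\infty$ means that the integral diverges at $+\infty$. Class $\mathcal{P}_\infty$: let $p\in C^1(0,\infty)$ be positive with $p'(t)<0$ for all $t>0$ and $\lim_{t\to0^+}p(t)=\infty$, and set $P(\tau)=\int_\tau^1p(s)\,ds$. Then $p$ is of class $\mathcal{P}_\infty$ if $$\int_{0^+}\left(P(\tau)\right)^{\frac{N-1}{N}}d\tau=\infty,$$ where $\int_{0^+}h(\tau)\,d\tau:=\lim_{\delta\to0^+}\int_\delta^b h(\tau)\,d\tau$ for some fixed $b>0$ (here one may take $b=1$). Function $H$: fix $a>0$ and let $$G(t)=\int_a^t\left(\frac{2N-1}{N-1}F(\tau)\right)^{-\frac{N-1}{2N-1}}d\tau,$$ which by (iii) tends to $\infty$ as $t\to\infty$. Define $$H(\tau)=-\frac{G(\tau)\,G''(\tau)}{\left[G'(\tau)\right]^2}.$$ *)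

theory Defs
  imports "HOL-Analysis.Analysis"
begin

definition partial_deriv :: "'n \<Rightarrow> (real^'n \<Rightarrow> real) \<Rightarrow> real^'n \<Rightarrow> real" where
  "partial_deriv i z x = frechet_derivative z (at x) (axis i 1)"

(* The C1 and C2 predicates are meant for open sets S. *)

definition C1_on :: "(real^'n) set \<Rightarrow> (real^'n \<Rightarrow> real) \<Rightarrow> bool" where
  "C1_on S z \<longleftrightarrow> (\<forall>x\<in>S. z differentiable (at x)) \<and> (\<forall>i. continuous_on S (partial_deriv i z))"

definition C2_on :: "(real^'n) set \<Rightarrow> (real^'n \<Rightarrow> real) \<Rightarrow> bool" where
  "C2_on S z \<longleftrightarrow> C1_on S z \<and> (\<forall>i. C1_on S (partial_deriv i z))"

definition hessian :: "(real^'n \<Rightarrow> real) \<Rightarrow> real^'n \<Rightarrow> real^'n^'n" where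
  "hessian z x = (\<chi> i j. partial_deriv i (partial_deriv j z) x)"

definition laplacian :: "(real^'n \<Rightarrow> real) \<Rightarrow> real^'n \<Rightarrow> real" where
  "laplacian z x = (\<Sum>i\<in>UNIV. partial_deriv i (partial_deriv i z) x)"

definition positive_definite :: "real^'n^'n \<Rightarrow> bool" where
  "positive_definite A \<longleftrightarrow> transpose A = A \<and> (\<forall>v. v \<noteq> 0 \<longrightarrow> v \<bullet> (A *v v) > 0)"

definition lap_hess_matrix :: "(real^'n \<Rightarrow> real) \<Rightarrow> real^'n \<Rightarrow> real^'n^'n" where
  "lap_hess_matrix z x = laplacian z x *\<^sub>R mat 1 - hessian z x"

(* (N-1)-convexity, where N = CARD('n). *)
definition Nm1_convex_on :: "(real^'n) set \<Rightarrow> (real^'n \<Rightarrow> real) \<Rightarrow> bool" where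
  "Nm1_convex_on S z \<longleftrightarrow> C2_on S z \<and> (\<forall>x\<in>S. positive_definite (lap_hess_matrix z x))"

(* u is C2 on [0,1), with one-sided derivatives at 0, and u'(0) = 0. *)
definition radial_profile :: "(real \<Rightarrow> real) \<Rightarrow> bool" where
  "radial_profile u \<longleftrightarrow> (\<exists>u' u''.
     (\<forall>r\<in>{0..<1}. (u has_real_derivative u' r) (at r within {0..<1})) \<and>
     (\<forall>r\<in>{0..<1}. (u' has_real_derivative u'' r) (at r within {0..<1})) \<and>
     continuous_on {0..<1} u'' \<and> u' 0 = 0)"

definition boundary_blow_up :: "(real^'n) set \<Rightarrow> (real^'n \<Rightarrow> real) \<Rightarrow> bool" where
  "boundary_blow_up S z \<longleftrightarrow>
     (\<forall>M. \<exists>\<delta>>0. \<forall>x\<in>S. infdist x (frontier S) < \<delta> \<longrightarrow> M < z x)"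

definition radial_solution :: "(real \<Rightarrow> real) \<Rightarrow> (real \<Rightarrow> real) \<Rightarrow> (real^'n \<Rightarrow> real) \<Rightarrow> bool" where
  "radial_solution K f z \<longleftrightarrow>
     C2_on (ball 0 1) z \<and>
     (\<exists>u. radial_profile u \<and> (\<forall>x\<in>ball 0 1. z x = u (norm x))) \<and>
     (\<forall>x\<in>ball 0 1. z x > 0) \<and>
     (\<forall>x\<in>ball 0 1. root (CARD('n) - 1) (det (lap_hess_matrix z x)) = K (norm x) * f (z x)) \<and>
     boundary_blow_up (ball 0 1) z"

definition F_fun :: "(real \<Rightarrow> real) \<Rightarrow> real \<Rightarrow> real" where
  "F_fun f \<tau> = (LBINT s=0..\<tau>. f s)"

(* The choice of b is immaterial for integrands continuous on (0,\<infinity>). *)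
definition integral_diverges_at_top :: "(real \<Rightarrow> real) \<Rightarrow> bool" where
  "integral_diverges_at_top h \<longleftrightarrow>
     (\<exists>b>0. filterlim (\<lambda>t::real. LBINT \<tau>=ereal b..ereal t. h \<tau>) at_top at_top)"

definition G_fun :: "nat \<Rightarrow> (real \<Rightarrow> real) \<Rightarrow> real \<Rightarrow> real \<Rightarrow> real" where
  "G_fun N f a t = (LBINT \<tau>=ereal a..ereal t.
     ((2 * real N - 1) / (real N - 1) * F_fun f \<tau>) powr (- ((real N - 1) / (2 * real N - 1))))"

definition H_fun :: "nat \<Rightarrow> (real \<Rightarrow> real) \<Rightarrow> real \<Rightarrow> real \<Rightarrow> real" where
  "H_fun N f a \<tau> = - (G_fun N f a \<tau> * deriv (deriv (G_fun N f a)) \<tau>) / (deriv (G_fun N f a) \<tau>)\<^sup>2"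

definition P_fun :: "(real \<Rightarrow> real) \<Rightarrow> real \<Rightarrow> real" where
  "P_fun p \<tau> = (LBINT s=ereal \<tau>..ereal 1. p s)"

definition class_P_infinity :: "nat \<Rightarrow> (real \<Rightarrow> real) set" where
  "class_P_infinity N = {p.
     p C1_differentiable_on {0<..} \<and>
     (\<forall>t>0. p t > 0) \<and>
     (\<forall>t>0. deriv p t < 0) \<and>
     filterlim p at_top (at_right 0) \<and>
     filterlim (\<lambda>\<delta>. LBINT \<tau>=ereal \<delta>..ereal 1. P_fun p \<tau> powr ((real N - 1) / real N))
       at_top (at_right 0)}"

end

theory Submission
  imports Defs
begin

text \<open>For \<open>z x = u (norm x)\<close> the matrix \<open>\<Delta>z I - D\<^sup>2z\<close> has the eigenvalue \<open>(N - 1) u' / r\<close> once and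
  \<open>u'' + (N - 2) u' / r\<close> with multiplicity \<open>N - 1\<close>, so the equation integrates to the fixed point problem
  \<open>u r = u\<^sub>0 + (\<integral>0..r. t (C A t) powr ((N - 1) / N) dt)\<close>, where
  \<open>A t = t powr (-N) (\<integral>0..t. s ^ (N - 1) K s f (u s) ds)\<close>.
  As \<open>f\<close> is nondecreasing, the map on the right is monotone and its iterates from the constant \<open>u\<^sub>0\<close> increase.
  An energy estimate and the divergence of the Keller--Osserman integral (iii) bound them locally uniformly
  on \<open>[0, 1)\<close>, so by dominated convergence their limit is a solution with central value \<open>u\<^sub>0\<close>.
  It blows up at \<open>r = 1\<close> because \<open>u' \<ge> \<mu> P (1 - r) powr ((N - 1) / N)\<close> there, whose integral diverges.
  Different central values give different solutions.\<close>

subsection \<open>Antiderivatives and radial means\<close>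

lemma LBINT_eq_integral:
  fixes g :: "real \<Rightarrow> real"
  assumes "continuous_on {a..b} g" "a \<le> b"
  shows "(LBINT y=ereal a..ereal b. g y) = integral {a..b} g"
  by (intro interval_integral_eq_integral borel_integrable_atLeastAtMost' assms)

lemma LBINT_has_real_derivative_upper:
  fixes g :: "real \<Rightarrow> real"
  assumes g: "continuous_on {a..b} g" and t: "a < t" "t < b"
  shows "((\<lambda>x. LBINT y=ereal a..ereal x. g y) has_real_derivative g t) (at t)"
proof -
  have "((\<lambda>x. integral {a..x} g) has_real_derivative g t) (at t)"
    using integral_has_real_derivative[OF g, of t] t at_within_Icc_at[of a t b] by auto
  moreover have "integral {a..x} g = (LBINT y=ereal a..ereal x. g y)" if "x \<in> {a<..<b}" for x
    using that continuous_on_subset[OF g, of "{a..x}"] by (subst LBINT_eq_integral) auto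
  ultimately show ?thesis
    using t by (elim has_field_derivative_transform_within_open[where S="{a<..<b}"]) auto
qed

lemma LBINT_has_real_derivative_lower:
  fixes g :: "real \<Rightarrow> real"
  assumes g: "continuous_on {a..b} g" and t: "a < t" "t < b"
  shows "((\<lambda>x. LBINT y=ereal x..ereal b. g y) has_real_derivative - g t) (at t)"
proof -
  have "((\<lambda>x. integral {x..b} g) has_real_derivative - g t) (at t)"
    using integral_has_real_derivative'[OF g, of t] t at_within_Icc_at[of a t b] by auto
  moreover have "integral {x..b} g = (LBINT y=ereal x..ereal b. g y)" if "x \<in> {a<..<b}" for x
    using that continuous_on_subset[OF g, of "{x..b}"] by (subst LBINT_eq_integral) auto
  ultimately show ?thesis
    using t by (elim has_field_derivative_transform_within_open[where S="{a<..<b}"]) auto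
qed

lemma DERIV_within_unit:
  assumes "(g has_real_derivative D) (at r within {0..<1})" "r \<in> {0<..<1::real}"
  shows "(g has_real_derivative D) (at r)"
  using assms(1) at_within_interior[of r "{0..<1}"] assms(2) by (simp add: interior_atLeastLessThan)

text \<open>This is the fundamental theorem of calculus. The behaviour of \<open>f\<close> at 0
  needs care: nothing is assumed about \<open>f\<close> on \<open>{..0}\<close>, and integrability
  near 0 comes from monotonicity, which bounds \<open>f\<close> on \<open>(0, t]\<close> by
  \<open>f t\<close>.\<close>

lemma F_fun_has_real_derivative:
  assumes pos: "\<And>s. s > 0 \<Longrightarrow> f s > 0" and mono: "mono_on {0<..} f"
    and cont: "continuous_on {0<..} f" and \<tau>: "\<tau> > 0"
  shows "(F_fun f has_real_derivative f \<tau>) (at \<tau>)"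
proof -
  \<comment> \<open>Extending by 0 keeps the function monotone on the whole line, hence Borel
    measurable and bounded on compact intervals.\<close>
  define g where "g s = (if s > 0 then f s else 0)" for s
  have "mono g"
    unfolding g_def using pos mono by (auto simp: mono_def mono_on_def intro: less_imp_le)
  have gi: "set_integrable lborel {0..t} g" for t
    unfolding set_integrable_def
  proof (rule integrableI_bounded_set_indicator)
    show "g \<in> borel_measurable lborel"
      using borel_measurable_mono[OF \<open>mono g\<close>] by simp
    show "AE x in lborel. x \<in> {0..t} \<longrightarrow> norm (g x) \<le> g t"
    proof (intro AE_I2 impI)
      fix x assume "x \<in> {0..t}"
      then have "0 \<le> g x" "g x \<le> g t"
        using pos monoD[OF \<open>mono g\<close>] by (auto simp: g_def less_imp_le)
      then show "norm (g x) \<le> g t" by simp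
    qed
  qed (auto simp: emeasure_lborel_Icc_eq)
  have Fg: "F_fun f t = integral {0..t} g" if "t > 0" for t
  proof -
    have "F_fun f t = (LBINT s=ereal 0..ereal t. g s)"
      unfolding F_fun_def zero_ereal_def[symmetric] using that
      by (intro interval_lebesgue_integral_cong) (auto simp: g_def zero_ereal_def)
    then show ?thesis
      using interval_integral_eq_integral[OF _ gi, of t] that by simp
  qed
  have g_int: "g integrable_on {0..t}" for t
    using gi[of t] by (rule set_borel_integral_eq_integral)
  have cg: "continuous_on {\<tau>/2..\<tau>+1} g"
    using \<tau> by (intro continuous_on_eq[OF continuous_on_subset[OF cont, of "{\<tau>/2..\<tau>+1}"]])
      (auto simp: g_def)
  \<comment> \<open>\<open>g\<close> may jump at 0, so the derivative is taken on
    \<open>{\<tau>/2..\<tau>+1}\<close>, where \<open>g\<close> is continuous; the integral up to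
    \<open>\<tau>/2\<close> is a constant.\<close>
  have split: "integral {0..\<tau>/2} g + integral {\<tau>/2..t} g = F_fun f t" if "t \<in> {\<tau>/2<..}" for t
    using that \<tau> Fg[of t] Henstock_Kurzweil_Integration.integral_combine[OF _ _ g_int, of "\<tau>/2" t] by auto
  have "((\<lambda>t. integral {0..\<tau>/2} g + integral {\<tau>/2..t} g) has_real_derivative 0 + g \<tau>) (at \<tau>)"
    using integral_has_real_derivative[OF cg, of \<tau>] \<tau> at_within_Icc_at[of "\<tau>/2" \<tau> "\<tau>+1"]
    by (intro derivative_intros) auto
  then have "(F_fun f has_real_derivative 0 + g \<tau>) (at \<tau>)"
    by (rule has_field_derivative_transform_within_open[where S="{\<tau>/2<..}"]) (use \<tau> split in auto)
  then show ?thesis using \<tau> by (simp add: g_def)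
qed

lemma F_fun_pos:
  assumes pos: "\<And>s. s > 0 \<Longrightarrow> f s > 0" and mono: "mono_on {0<..} f"
    and cont: "continuous_on {0<..} f" and \<tau>: "\<tau> > 0"
  shows "F_fun f \<tau> > 0"
proof -
  have "0 \<le> F_fun f (\<tau>/2)"
    unfolding F_fun_def zero_ereal_def using \<tau> pos
    by (auto simp: interval_lebesgue_integral_def set_lebesgue_integral_def less_imp_le
        intro!: integral_nonneg_AE AE_I2 split: split_indicator)
  also have "F_fun f (\<tau>/2) < F_fun f \<tau>"
  proof (rule DERIV_pos_imp_increasing[of "\<tau>/2" \<tau> "F_fun f"])
    fix x assume "\<tau>/2 \<le> x" "x \<le> \<tau>"
    then have "x > 0" using \<tau> by simp
    then show "\<exists>y. DERIV (F_fun f) x :> y \<and> 0 < y"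
      using F_fun_has_real_derivative[OF pos mono cont] pos by blast
  qed (use \<tau> in auto)
  finally show ?thesis .
qed

text \<open>For \<open>t > 0\<close> this is \<open>t powr (- m - 1)\<close> times the integral of
  \<open>s ^ m * k s\<close> over \<open>{0..t}\<close>, after the substitution
  \<open>s = t * \<sigma>\<close>. The rescaled form has no singularity at \<open>t = 0\<close>. For
  \<open>m = N - 1\<close> it is, up to the factor \<open>1 / N\<close>, the mean of
  \<open>k (norm x)\<close> over the ball of radius \<open>t\<close>.\<close>

definition radial_mean :: "nat \<Rightarrow> (real \<Rightarrow> real) \<Rightarrow> real \<Rightarrow> real" where
  "radial_mean m k t = integral {0..1} (\<lambda>\<sigma>. \<sigma> ^ m * k (t * \<sigma>))"

lemma mult_unit_interval:
  fixes t \<sigma> :: real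
  assumes "t \<in> {0..<1}" "\<sigma> \<in> {0..1}"
  shows "t * \<sigma> \<in> {0..<1}" "t * \<sigma> \<in> {0..t}"
  using assms mult_left_le[of \<sigma> t] by auto

lemma continuous_on_radial_mean:
  assumes k: "continuous_on {0..<1} k"
  shows "continuous_on {0..<1} (radial_mean m k)"
proof -
  have "continuous_on ({0..<1} \<times> {0..1}) (\<lambda>x. snd x ^ m * k (fst x * snd x))"
    by (intro continuous_intros continuous_on_compose2[OF k])
      (use mult_unit_interval in \<open>force simp: image_subset_iff\<close>)
  then have "continuous_on {0..<1} (\<lambda>t. integral (cbox 0 1) (\<lambda>\<sigma>. \<sigma> ^ m * k (t * \<sigma>)))"
    by (intro integral_continuous_on_param) (simp add: case_prod_unfold)
  then show ?thesis by (simp add: radial_mean_def[abs_def])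
qed

lemma radial_mean_integrand_continuous:
  fixes k :: "real \<Rightarrow> real"
  assumes k: "continuous_on {0..<1} k" and t: "t \<in> {0..<1}"
  shows "continuous_on {0..1} (\<lambda>\<sigma>. \<sigma> ^ m * k (t * \<sigma>))"
  by (intro continuous_intros continuous_on_compose2[OF k])
      (use mult_unit_interval[OF t] in \<open>force simp: image_subset_iff\<close>)

lemma radial_mean_mono:
  assumes k: "continuous_on {0..<1} k" and l: "continuous_on {0..<1} l" and t: "t \<in> {0..<1}"
    and le: "\<And>s. s \<in> {0..t} \<Longrightarrow> k s \<le> l s"
  shows "radial_mean m k t \<le> radial_mean m l t"
  unfolding radial_mean_def
  by (intro integral_le integrable_continuous_real radial_mean_integrand_continuous k l t mult_left_mono le)
    (use mult_unit_interval[OF t] in auto)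

lemma radial_mean_const: "radial_mean m (\<lambda>_. c) t = c / (real m + 1)"
proof -
  have "((\<lambda>\<sigma>. \<sigma> ^ Suc m * (c / (real m + 1))) has_real_derivative x ^ m * c) (at x within {0..1})" for x :: real
  proof -
    have "((\<lambda>\<sigma>. \<sigma> ^ Suc m * (c / (real m + 1))) has_real_derivative
        (1 + real m) * (1 * x ^ m) * (c / (real m + 1))) (at x within {0..1})"
      by (rule DERIV_cmult_right[OF DERIV_power_Suc[OF DERIV_ident]])
    moreover have "(1 + real m) * (1 * x ^ m) * (c / (real m + 1)) = x ^ m * c"
      by (simp add: field_simps)
    ultimately show ?thesis by (simp only:)
  qed
  then have "((\<lambda>\<sigma>. \<sigma> ^ m * c) has_integral
      (1 ^ Suc m * (c / (real m + 1)) - 0 ^ Suc m * (c / (real m + 1)))) {0..1}"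
    by (intro fundamental_theorem_of_calculus)
      (auto simp: has_real_derivative_iff_has_vector_derivative[symmetric] simp del: power_Suc)
  then have "((\<lambda>\<sigma>. \<sigma> ^ m * c) has_integral c / (real m + 1)) {0..1}" by simp
  then show ?thesis unfolding radial_mean_def by (rule integral_unique)
qed

lemma radial_mean_0: "radial_mean m k 0 = k 0 / (real m + 1)"
  using radial_mean_const[of m "k 0" 0] by (simp add: radial_mean_def)

text \<open>On the compact interval \<open>{0..t}\<close> the function \<open>k\<close> attains a
  positive minimum, and the mean is compared with that of this constant.\<close>

lemma radial_mean_pos:
  assumes k: "continuous_on {0..<1} k" and pos: "\<And>s. s \<in> {0..<1} \<Longrightarrow> k s > 0" and t: "t \<in> {0..<1}"
  shows "radial_mean m k t > 0"
proof -
  have "continuous_on {0..t} k" using k t by (auto intro: continuous_on_subset)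
  then obtain s where s: "s \<in> {0..t}" "\<And>y. y \<in> {0..t} \<Longrightarrow> k s \<le> k y"
    using continuous_attains_inf[of "{0..t}" k] t by auto
  have "0 < k s / (real m + 1)" using pos s(1) t by auto
  also have "\<dots> \<le> radial_mean m k t"
    using radial_mean_mono[OF _ k t s(2), where m=m] by (simp add: radial_mean_const)
  finally show ?thesis .
qed

lemma power_times_radial_mean:
  assumes k: "continuous_on {0..<1} k" and t: "t \<in> {0..<1}"
  shows "t ^ Suc m * radial_mean m k t = integral {0..t} (\<lambda>s. s ^ m * k s)"
proof -
  have kt: "continuous_on {0..t} (\<lambda>s. s ^ m * k s)"
    using k t by (intro continuous_intros) (auto intro: continuous_on_subset)
  have sub: "(\<lambda>\<sigma>. t * \<sigma>) ` {0..1} \<subseteq> {0..t}"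
    using mult_unit_interval(2)[OF t] by blast
  have "((\<lambda>\<sigma>. t *\<^sub>R ((t * \<sigma>) ^ m * k (t * \<sigma>))) has_integral
      integral {t * 0..t * 1} (\<lambda>s. s ^ m * k s)) {0..1}"
    by (rule has_integral_substitution[OF _ _ sub kt]) (use t in \<open>auto intro!: derivative_eq_intros\<close>)
  then have "integral {0..t} (\<lambda>s. s ^ m * k s) = integral {0..1} (\<lambda>\<sigma>. t *\<^sub>R ((t * \<sigma>) ^ m * k (t * \<sigma>)))"
    by (simp only: integral_unique mult_zero_right mult_1_right)
  also have "\<dots> = integral {0..1} (\<lambda>\<sigma>. t ^ Suc m * (\<sigma> ^ m * k (t * \<sigma>)))"
    by (simp add: power_mult_distrib mult_ac)
  finally show ?thesis by (simp add: radial_mean_def)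
qed

text \<open>For positive arguments the mean is the integral of \<open>s ^ m * k s\<close> divided by
  \<open>x ^ Suc m\<close>, and the quotient rule applies.\<close>

lemma radial_mean_has_real_derivative:
  assumes k: "continuous_on {0..<1} k" and t: "t \<in> {0<..<1}"
  shows "(radial_mean m k has_real_derivative (k t - (real m + 1) * radial_mean m k t) / t) (at t)"
proof -
  define b where "b = (1 + t) / 2"
  have b: "0 < t" "t < b" "b < 1" using t by (auto simp: b_def)
  have kb: "continuous_on {0..b} (\<lambda>s. s ^ m * k s)"
    using k b by (intro continuous_intros) (auto intro: continuous_on_subset)
  let ?\<Phi> = "\<lambda>x. integral {0..x} (\<lambda>s. s ^ m * k s)"
  have d\<Phi>: "(?\<Phi> has_real_derivative t ^ m * k t) (at t)"
    using integral_has_real_derivative[OF kb, of t] b at_within_Icc_at[of 0 t b] by auto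
  have "((\<lambda>x. ?\<Phi> x / x ^ Suc m) has_real_derivative
      ((t ^ m * k t) * t ^ Suc m - ?\<Phi> t * ((1 + real m) * (1 * t ^ m))) / (t ^ Suc m * t ^ Suc m)) (at t)"
    using b by (intro DERIV_divide[OF d\<Phi> DERIV_power_Suc[OF DERIV_ident]]) auto
  also have "((t ^ m * k t) * t ^ Suc m - ?\<Phi> t * ((1 + real m) * (1 * t ^ m))) / (t ^ Suc m * t ^ Suc m)
      = (k t - (real m + 1) * radial_mean m k t) / t"
  proof -
    have "?\<Phi> t = t ^ Suc m * radial_mean m k t"
      using power_times_radial_mean[OF k, of t m] t by auto
    then show ?thesis using b by (simp add: field_simps)
  qed
  finally show ?thesis
    by (rule has_field_derivative_transform_within_open[where S="{0<..<1}"])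
      (use t in \<open>auto simp: power_times_radial_mean[OF k, symmetric]\<close>)
qed

subsection \<open>The radial form of the equation\<close>

locale radial_source =
  fixes N :: nat and k :: "real \<Rightarrow> real"
  assumes N_ge_2: "N \<ge> 2"
    and k_cont: "continuous_on {0..<1} k" and k_pos: "\<And>r. r \<in> {0..<1} \<Longrightarrow> k r > 0"

text \<open>If the right-hand side of the equation is \<open>k r\<close>, then \<open>radial_slope N k r\<close> is \<open>u' / r\<close> and
  \<open>tangential_eigenvalue N k r\<close> is \<open>u'' + (N - 2) u' / r\<close>. Averaging over \<open>[0, 1]\<close> in \<open>radial_mean\<close>
  keeps both regular at \<open>r = 0\<close>.\<close>

definition radial_const :: "nat \<Rightarrow> real" where
  "radial_const N = real N / (real N - 1) * (real N - 1) powr (- 1 / (real N - 1))"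

definition radial_slope :: "nat \<Rightarrow> (real \<Rightarrow> real) \<Rightarrow> real \<Rightarrow> real" where
  "radial_slope N k r = (radial_const N * radial_mean (N - 1) k r) powr ((real N - 1) / real N)"

definition tangential_eigenvalue :: "nat \<Rightarrow> (real \<Rightarrow> real) \<Rightarrow> real \<Rightarrow> real" where
  "tangential_eigenvalue N k r = radial_const N * ((real N - 1) / real N) * k r *
     (radial_const N * radial_mean (N - 1) k r) powr (- 1 / real N)"

lemma radial_const_pos: "N \<ge> 2 \<Longrightarrow> radial_const N > 0"
  by (auto simp: radial_const_def)

context radial_source
begin

abbreviation "A \<equiv> \<lambda>r. radial_const N * radial_mean (N - 1) k r"
abbreviation "h \<equiv> radial_slope N k"
abbreviation "\<alpha> \<equiv> tangential_eigenvalue N k"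

lemma A_pos: "r \<in> {0..<1} \<Longrightarrow> A r > 0"
  using radial_const_pos[OF N_ge_2] radial_mean_pos[OF k_cont k_pos] by simp

lemma slope_pos: "r \<in> {0..<1} \<Longrightarrow> h r > 0"
  using A_pos[of r] by (auto simp: radial_slope_def zero_less_mult_iff)

lemma tangential_pos: "r \<in> {0..<1} \<Longrightarrow> \<alpha> r > 0"
  using A_pos[of r] N_ge_2 k_pos[of r] radial_const_pos[of N] unfolding tangential_eigenvalue_def
  by (intro mult_pos_pos) auto

lemma continuous_on_A: "continuous_on {0..<1} A"
  by (intro continuous_intros continuous_on_radial_mean k_cont)

lemma continuous_on_slope: "continuous_on {0..<1} h"
  unfolding radial_slope_def[abs_def] using A_pos
  by (intro continuous_on_powr continuous_on_A continuous_on_const ballI) (metis less_irrefl)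

lemma continuous_on_tangential: "continuous_on {0..<1} \<alpha>"
  unfolding tangential_eigenvalue_def[abs_def] using A_pos
  by (intro continuous_on_powr continuous_on_A continuous_on_mult continuous_on_const k_cont ballI)
    (metis less_irrefl)

lemma slope_eq: "r \<in> {0..<1} \<Longrightarrow> h r = A r * A r powr (- 1 / real N)"
  using A_pos[of r] N_ge_2 powr_add[of "A r" 1 "- 1 / real N"]
  by (simp add: radial_slope_def diff_divide_distrib)

text \<open>At the origin \<open>radial_mean\<close> is \<open>k 0 / N\<close>. The resulting
  agreement of all eigenvalues there makes \<open>u''\<close> continuous at 0 and the Hessian of
  \<open>z\<close> continuous at the origin.\<close>

lemma tangential_0: "\<alpha> 0 = (real N - 1) * h 0"
proof -
  have k0: "k 0 = real N * radial_mean (N - 1) k 0"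
    using N_ge_2 by (simp add: radial_mean_0 of_nat_diff)
  have h0: "h 0 = A 0 * A 0 powr (- 1 / real N)"
    by (rule slope_eq) simp
  show ?thesis
    unfolding h0 tangential_eigenvalue_def k0 using N_ge_2 by simp
qed

lemma slope_has_real_derivative:
  assumes r: "r \<in> {0<..<1}"
  shows "(h has_real_derivative (\<alpha> r - (real N - 1) * h r) / r) (at r)"
proof -
  have r': "r \<in> {0..<1}" using r by simp
  let ?q = "(real N - 1) / real N"
  have "(A has_real_derivative radial_const N * ((k r - (real (N - 1) + 1) * radial_mean (N - 1) k r) / r)) (at r)"
    by (intro DERIV_cmult radial_mean_has_real_derivative k_cont r)
  from DERIV_fun_powr[OF this A_pos[OF r'], of ?q]
  have "(h has_real_derivative ?q * A r powr (?q - 1) *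
      (radial_const N * ((k r - (real (N - 1) + 1) * radial_mean (N - 1) k r) / r))) (at r)"
    by (simp add: radial_slope_def[abs_def])
  also have "?q - 1 = - 1 / real N"
    using N_ge_2 by (simp add: field_simps)
  also have "?q * A r powr (- 1 / real N) *
      (radial_const N * ((k r - (real (N - 1) + 1) * radial_mean (N - 1) k r) / r))
      = (\<alpha> r - (real N - 1) * h r) / r"
    unfolding slope_eq[OF r'] tangential_eigenvalue_def using N_ge_2 r
    by (simp add: field_simps of_nat_diff)
  finally show ?thesis .
qed

lemma radial_derivative_has_real_derivative:
  assumes r: "r \<in> {0..<1}"
  shows "((\<lambda>r. r * h r) has_real_derivative \<alpha> r - (real N - 2) * h r) (at r within {0..<1})"
proof (cases "r = 0")
  case True
  \<comment> \<open>At 0 the difference quotient of \<open>r * h r\<close> is \<open>h r\<close>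
    itself, so continuity of \<open>h\<close> gives the derivative \<open>h 0\<close>;
    \<open>tangential_0\<close> matches it with the general formula.\<close>
  have "(h \<longlongrightarrow> h 0) (at 0 within {0..<1})"
    using continuous_on_slope by (auto simp: continuous_on_def)
  then have "((\<lambda>y. (y * h y - 0 * h 0) / (y - 0)) \<longlongrightarrow> h 0) (at 0 within {0..<1})"
    by (rule Lim_transform_eventually) (auto simp: eventually_at_filter)
  then have "((\<lambda>r. r * h r) has_real_derivative h 0) (at 0 within {0..<1})"
    by (simp add: has_field_derivative_iff)
  moreover have "h 0 = \<alpha> 0 - (real N - 2) * h 0"
    using tangential_0 by (simp add: algebra_simps)
  ultimately show ?thesis using True by simp
next
  case False
  then have r': "r \<in> {0<..<1}" using r by auto
  have "((\<lambda>r. r * h r) has_real_derivative 1 * h r + (\<alpha> r - (real N - 1) * h r) / r * r) (at r)"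
    by (intro DERIV_mult DERIV_ident slope_has_real_derivative r')
  also have "1 * h r + (\<alpha> r - (real N - 1) * h r) / r * r = \<alpha> r - (real N - 2) * h r"
    using False by simp (simp add: algebra_simps)
  finally show ?thesis by (rule has_field_derivative_at_within)
qed

lemma slope_powr_tangential:
  assumes r: "r \<in> {0..<1}"
  shows "h r powr (1 / (real N - 1)) * \<alpha> r = radial_const N * ((real N - 1) / real N) * k r"
proof -
  have "h r powr (1 / (real N - 1)) = A r powr (1 / real N)"
    using N_ge_2 by (simp add: radial_slope_def powr_powr)
  moreover have "A r powr (1 / real N) * A r powr (- 1 / real N) = 1"
    using A_pos[OF r] by (auto simp: powr_add[symmetric] zero_less_mult_iff)
  ultimately show ?thesis by (simp add: tangential_eigenvalue_def algebra_simps)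
qed

text \<open>This is the determinant equation in radial form, and it dictates
  \<open>radial_const\<close>. Since \<open>\<alpha> = r h' + (N - 1) h\<close>, the function
  \<open>y = h powr (N / (N - 1))\<close> must satisfy
  \<open>r y' + N y = radial_const N * k\<close>. Hence \<open>r ^ N * y\<close> has derivative
  \<open>radial_const N * r ^ (N - 1) * k\<close>, which makes \<open>y\<close> equal to
  \<open>A\<close>.\<close>

lemma radial_equation:
  assumes r: "r \<in> {0..<1}"
  shows "((real N - 1) * h r) powr (1 / (real N - 1)) * \<alpha> r = k r"
proof -
  have "((real N - 1) * h r) powr (1 / (real N - 1)) * \<alpha> r
      = (real N - 1) powr (1 / (real N - 1)) * (radial_const N * ((real N - 1) / real N) * k r)"
    using slope_powr_tangential[OF r] slope_pos[OF r] N_ge_2 by (simp add: powr_mult mult.assoc)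
  also have "\<dots> = (real N - 1) powr (1 / (real N - 1)) * (real N - 1) powr (- 1 / (real N - 1)) * k r"
    using N_ge_2 by (simp add: radial_const_def)
  also have "\<dots> = k r"
    using N_ge_2 by (simp add: powr_add[symmetric])
  finally show ?thesis .
qed

end

lemma radial_slope_mono:
  assumes N: "N \<ge> 2" and k: "continuous_on {0..<1} k" and l: "continuous_on {0..<1} l" and t: "t \<in> {0..<1}"
    and pos: "\<And>s. s \<in> {0..<1} \<Longrightarrow> k s > 0"
    and le: "\<And>s. s \<in> {0..t} \<Longrightarrow> k s \<le> l s"
  shows "radial_slope N k t \<le> radial_slope N l t"
proof -
  interpret radial_source N k using N k pos by unfold_locales auto
  show ?thesis
    unfolding radial_slope_def using N A_pos[OF t] radial_const_pos[OF N]
    by (intro powr_mono2 mult_left_mono radial_mean_mono k l t le) auto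
qed

subsection \<open>A priori bounds for the monotone iteration\<close>

locale radial_problem =
  fixes N :: nat and K f :: "real \<Rightarrow> real" and b :: real
  assumes N_ge_2: "N \<ge> 2"
    and K_cont: "continuous_on {0..<1} K" and K_pos: "\<And>r. r \<in> {0..<1} \<Longrightarrow> K r > 0"
    and f_pos: "\<And>s. s > 0 \<Longrightarrow> f s > 0"
    and f_mono: "mono_on {0<..} f"
    and f_cont: "continuous_on {0<..} f"
    and b_pos: "b > 0"
    and F_div: "filterlim (\<lambda>t::real. LBINT \<tau>=ereal b..ereal t.
      F_fun f \<tau> powr (- ((real N - 1) / (2 * real N - 1)))) at_top at_top"
begin

abbreviation "F \<equiv> F_fun f"

text \<open>An antiderivative of the Keller-Osserman integrand. As it tends to infinity, a bound on
  \<open>keller (V r)\<close> bounds \<open>V r\<close>. It is differentiated only beyond its base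
  point \<open>b\<close>, which is why central values are taken above \<open>b\<close>.\<close>

definition keller :: "real \<Rightarrow> real" where
  "keller t = (LBINT \<tau>=ereal b..ereal t. F \<tau> powr (- ((real N - 1) / (2 * real N - 1))))"

abbreviation "source v \<equiv> \<lambda>r. K r * f (v r)"
abbreviation "slope v \<equiv> radial_slope N (source v)"

definition radial_map :: "real \<Rightarrow> (real \<Rightarrow> real) \<Rightarrow> real \<Rightarrow> real" where
  "radial_map u\<^sub>0 v r = u\<^sub>0 + integral {0..r} (\<lambda>t. t * slope v t)"

lemma F_deriv: "t > 0 \<Longrightarrow> (F has_real_derivative f t) (at t)"
  by (rule F_fun_has_real_derivative[OF f_pos f_mono f_cont])

lemma F_pos: "t > 0 \<Longrightarrow> F t > 0"
  by (rule F_fun_pos[OF f_pos f_mono f_cont])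

lemma keller_has_real_derivative:
  assumes "t > b"
  shows "(keller has_real_derivative F t powr (- ((real N - 1) / (2 * real N - 1)))) (at t)"
proof -
  have "continuous_on {b..t+1} (\<lambda>\<tau>. F \<tau> powr (- ((real N - 1) / (2 * real N - 1))))"
    using b_pos F_pos
    by (intro continuous_on_powr continuous_on_const DERIV_continuous_on[OF has_field_derivative_at_within[OF F_deriv]])
      (auto simp: less_imp_neq[THEN not_sym])
  then show ?thesis
    unfolding keller_def[abs_def] using assms by (intro LBINT_has_real_derivative_upper) auto
qed

lemma source_cont:
  assumes "continuous_on {0..<1} v" "\<And>r. r \<in> {0..<1} \<Longrightarrow> v r > 0"
  shows "continuous_on {0..<1} (source v)"
  by (intro continuous_on_mult K_cont continuous_on_compose2[OF f_cont assms(1)]) (use assms(2) in auto)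

lemma radial_source_source:
  assumes "continuous_on {0..<1} v" "\<And>r. r \<in> {0..<1} \<Longrightarrow> v r > 0"
  shows "radial_source N (source v)"
  using assms N_ge_2 K_pos f_pos source_cont by unfold_locales auto

lemma radial_map_0: "radial_map u\<^sub>0 v 0 = u\<^sub>0"
  by (simp add: radial_map_def)

lemma radial_map_has_real_derivative:
  assumes v: "continuous_on {0..<1} v" "\<And>r. r \<in> {0..<1} \<Longrightarrow> v r > 0" and r: "r \<in> {0..<1}"
  shows "(radial_map u\<^sub>0 v has_real_derivative r * slope v r) (at r within {0..<1})"
proof -
  interpret radial_source N "source v" by (rule radial_source_source[OF v])
  define R where "R = (1 + r) / 2"
  have R: "r < R" "R < 1" using r by (auto simp: R_def)
  have "continuous_on {0..R} (\<lambda>t. t * slope v t)"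
    using R by (intro continuous_on_mult continuous_on_id continuous_on_subset[OF continuous_on_slope]) auto
  from integral_has_real_derivative[OF this, of r] r R
  have "(radial_map u\<^sub>0 v has_real_derivative 0 + r * slope v r) (at r within {0..R})"
    unfolding radial_map_def[abs_def] by (intro DERIV_add) auto
  moreover have "at r within {0..R} = at r within {0..<1}"
    by (rule at_within_nhd[of _ "{..<R}"]) (use r R in auto)
  ultimately show ?thesis by simp
qed

lemma continuous_on_radial_map:
  assumes v: "continuous_on {0..<1} v" "\<And>r. r \<in> {0..<1} \<Longrightarrow> v r > 0"
  shows "continuous_on {0..<1} (radial_map u\<^sub>0 v)"
  by (rule DERIV_continuous_on[OF radial_map_has_real_derivative[OF v]])

lemma radial_map_ge:
  assumes v: "continuous_on {0..<1} v" "\<And>r. r \<in> {0..<1} \<Longrightarrow> v r > 0" and r: "r \<in> {0..<1}"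
  shows "radial_map u\<^sub>0 v r \<ge> u\<^sub>0"
proof -
  interpret radial_source N "source v" by (rule radial_source_source[OF v])
  have "radial_map u\<^sub>0 v 0 \<le> radial_map u\<^sub>0 v r"
  proof (rule DERIV_nonneg_imp_increasing_open[of 0 r])
    fix x assume "0 < x" "x < r"
    then show "\<exists>y. (radial_map u\<^sub>0 v has_real_derivative y) (at x) \<and> 0 \<le> y"
      using r slope_pos[of x]
      by (intro exI[of _ "x * slope v x"] conjI DERIV_within_unit radial_map_has_real_derivative v) auto
  qed (use r in \<open>auto intro: continuous_on_subset[OF continuous_on_radial_map[OF v]]\<close>)
  then show ?thesis by (simp add: radial_map_0)
qed

lemma radial_map_mono:
  assumes v: "continuous_on {0..<1} v" "\<And>r. r \<in> {0..<1} \<Longrightarrow> v r > 0"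
    and w: "continuous_on {0..<1} w" "\<And>r. r \<in> {0..<1} \<Longrightarrow> v r \<le> w r" and r: "r \<in> {0..<1}"
  shows "radial_map u\<^sub>0 v r \<le> radial_map u\<^sub>0 w r"
proof -
  have wp: "w r > 0" if "r \<in> {0..<1}" for r using v(2)[OF that] w(2)[OF that] by simp
  interpret v: radial_source N "source v" by (rule radial_source_source[OF v])
  interpret w: radial_source N "source w" by (rule radial_source_source[OF w(1) wp])
  have "integral {0..r} (\<lambda>t. t * slope v t) \<le> integral {0..r} (\<lambda>t. t * slope w t)"
  proof (rule integral_le)
    fix t assume t: "t \<in> {0..r}"
    have "source v s \<le> source w s" if "s \<in> {0..t}" for s
    proof -
      have s: "s \<in> {0..<1}" using that t r by auto
      then have "f (v s) \<le> f (w s)"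
        using v(2) w(2) wp by (intro mono_onD[OF f_mono]) auto
      then show ?thesis using K_pos[OF s] by (simp add: mult_left_mono)
    qed
    then have "slope v t \<le> slope w t"
      using t r N_ge_2 v.k_pos by (intro radial_slope_mono v.k_cont w.k_cont) auto
    then show "t * slope v t \<le> t * slope w t" using t by (simp add: mult_left_mono)
  qed (use r in \<open>auto intro!: integrable_continuous_real continuous_on_mult
      continuous_on_subset[OF v.continuous_on_slope] continuous_on_subset[OF w.continuous_on_slope]\<close>)
  then show ?thesis by (simp add: radial_map_def)
qed

text \<open>The energy \<open>w powr e / e - c * F V\<close> of \<open>w = V'\<close> is nonincreasing, even though the source involves
  only the smaller function \<open>v\<close>; hence the bound is uniform along the monotone iteration.\<close>

lemma keller_radial_map_le:
  assumes v: "continuous_on {0..<1} v" "\<And>r. r \<in> {0..<1} \<Longrightarrow> v r > 0"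
    and u0: "u\<^sub>0 > b" and le: "\<And>r. r \<in> {0..<1} \<Longrightarrow> v r \<le> radial_map u\<^sub>0 v r"
    and R: "R < 1" and M: "\<And>r. r \<in> {0..R} \<Longrightarrow> K r \<le> M" and r: "r \<in> {0..R}"
  defines "e \<equiv> (2 * real N - 1) / (real N - 1)"
  defines "c \<equiv> radial_const N * ((real N - 1) / real N) * M"
  shows "keller (radial_map u\<^sub>0 v r) \<le> keller u\<^sub>0 + (e * c) powr (1 / e)"
proof -
  interpret radial_source N "source v" by (rule radial_source_source[OF v])
  have N1: "real N - 1 > 0" using N_ge_2 by simp
  let ?V = "radial_map u\<^sub>0 v"
  define w where "w r = r * slope v r" for r
  have rR: "s \<in> {0..<1}" if "s \<in> {0..R}" for s using that R by auto
  have V: "?V s \<ge> u\<^sub>0" if "s \<in> {0..R}" for s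
    using radial_map_ge[OF v rR[OF that]] .
  \<comment> \<open>The value of \<open>e\<close> is forced by the energy:
    \<open>w powr (e - 1)\<close> has to be \<open>w\<close> times the factor
    \<open>w powr (1 / (N - 1))\<close> occurring in the radial equation. Then \<open>1 / e\<close>
    is exactly the Keller-Osserman exponent.\<close>
  have e: "e > 0" "1 / e = (real N - 1) / (2 * real N - 1)" "e - 1 = 1 + 1 / (real N - 1)"
    using N1 by (auto simp: e_def field_simps)
  have Mp: "M > 0" using M[of 0] K_pos[of 0] r by auto
  have c: "c > 0" using radial_const_pos[OF N_ge_2] Mp N1 unfolding c_def by (intro mult_pos_pos) auto
  have Vcont: "continuous_on {0..R} ?V"
    using R by (intro continuous_on_subset[OF continuous_on_radial_map[OF v]]) auto
  have wcont: "continuous_on {0..R} w"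
    unfolding w_def using R
    by (intro continuous_on_mult continuous_on_id continuous_on_subset[OF continuous_on_slope]) auto
  have w_nonneg: "w s \<ge> 0" if "s \<in> {0..R}" for s
    using that slope_pos[OF rR[OF that]] by (auto simp: w_def)
  have dV: "(?V has_real_derivative w s) (at s)" if "0 < s" "s < R" for s
    unfolding w_def using that R
    by (intro DERIV_within_unit radial_map_has_real_derivative v) auto
  have FV: "continuous_on {0..R} (\<lambda>s. F (?V s))"
    using V u0 b_pos
    by (intro continuous_on_compose2[OF DERIV_continuous_on[OF has_field_derivative_at_within[OF F_deriv]] Vcont, of "{0<..}"])
       force+
  have energy: "w s powr e / e - c * F (?V s) \<le> 0" if s: "s \<in> {0..R}" for s
  proof -
    have "w s powr e / e - c * F (?V s) \<le> w 0 powr e / e - c * F (?V 0)"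
    proof (rule DERIV_nonpos_imp_decreasing_open[of 0 s])
      fix x assume x: "0 < x" "x < s"
      then have xR: "x \<in> {0..R}" "x \<in> {0..<1}" "x \<in> {0<..<1}" using s R by auto
      have wx: "w x > 0" "w x \<le> slope v x"
        using x slope_pos[OF xR(2)] xR by (auto simp: w_def)
      have dw: "(w has_real_derivative \<alpha> x - (real N - 2) * slope v x) (at x)"
        unfolding w_def by (intro DERIV_within_unit radial_derivative_has_real_derivative xR)
      let ?D = "w x powr (e - 1) * (\<alpha> x - (real N - 2) * slope v x) - c * (f (?V x) * w x)"
      have "((\<lambda>s. w s powr e / e) has_real_derivative
          (e * w x powr (e - of_nat 1) * (\<alpha> x - (real N - 2) * slope v x)) / e) (at x)"
        by (intro DERIV_cdivide DERIV_fun_powr dw wx)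
      moreover have "((\<lambda>s. F (?V s)) has_real_derivative f (?V x) * w x) (at x)"
        using V[OF xR(1)] u0 b_pos x s by (intro DERIV_chain2[OF F_deriv dV]) auto
      ultimately have "((\<lambda>s. w s powr e / e - c * F (?V s)) has_real_derivative ?D) (at x)"
        using e(1) by (auto intro!: DERIV_diff DERIV_cmult)
      \<comment> \<open>Three estimates are combined: the term \<open>(N - 2) * slope v x\<close> of
        \<open>w'\<close> is dropped; \<open>w x \<le> slope v x\<close> because
        \<open>x < 1\<close>, so \<open>slope_powr_tangential\<close> applies; and
        \<open>K x * f (v x) \<le> M * f (?V x)\<close> because \<open>v \<le> ?V\<close> and
        \<open>f\<close> is nondecreasing.\<close>
      moreover have "?D \<le> 0"
      proof -
        have "\<alpha> x - (real N - 2) * slope v x \<le> \<alpha> x"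
          using N_ge_2 slope_pos[OF xR(2)] by simp
        then have "w x powr (1 / (real N - 1)) * (\<alpha> x - (real N - 2) * slope v x)
            \<le> w x powr (1 / (real N - 1)) * \<alpha> x"
          by (simp add: mult_left_mono)
        also have "\<dots> \<le> slope v x powr (1 / (real N - 1)) * \<alpha> x"
          using wx N1 tangential_pos[OF xR(2)] by (intro mult_right_mono powr_mono2) auto
        also have "\<dots> = radial_const N * ((real N - 1) / real N) * (K x * f (v x))"
          by (rule slope_powr_tangential[OF xR(2)])
        also have "\<dots> \<le> radial_const N * ((real N - 1) / real N) * (M * f (?V x))"
        proof -
          have "f (v x) \<le> f (?V x)"
            using v(2)[OF xR(2)] le[OF xR(2)] by (intro mono_onD[OF f_mono]) auto
          then have "K x * f (v x) \<le> M * f (?V x)"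
            using M[OF xR(1)] K_pos[OF xR(2)] f_pos[OF v(2)[OF xR(2)]] by (intro mult_mono) auto
          then show ?thesis
            using radial_const_pos[OF N_ge_2] N1 by (intro mult_left_mono) auto
        qed
        also have "\<dots> = c * f (?V x)" by (simp add: c_def)
        finally have "w x * (w x powr (1 / (real N - 1)) * (\<alpha> x - (real N - 2) * slope v x)) \<le> w x * (c * f (?V x))"
          using wx by (intro mult_left_mono) auto
        moreover have "w x powr (e - 1) = w x * w x powr (1 / (real N - 1))"
          using wx by (simp add: e(3) powr_add)
        ultimately show ?thesis by (simp add: algebra_simps)
      qed
      ultimately show "\<exists>y. ((\<lambda>s. w s powr e / e - c * F (?V s)) has_real_derivative y) (at x) \<and> y \<le> 0"
        by blast
    next
      have "continuous_on {0..R} (\<lambda>s. w s powr e / e - c * F (?V s))"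
        using w_nonneg e(1)
        by (intro continuous_intros continuous_on_powr' wcont FV) auto
      then show "continuous_on {0..s} (\<lambda>s. w s powr e / e - c * F (?V s))"
        using s by (auto intro: continuous_on_subset)
    qed (use s in auto)
    \<comment> \<open>The initial energy is \<open>- c * F u\<^sub>0\<close>, since \<open>w\<close>
      vanishes at 0.\<close>
    also have "\<dots> \<le> 0"
      using c F_pos[of u\<^sub>0] u0 b_pos by (simp add: w_def radial_map_0)
    finally show ?thesis .
  qed
  \<comment> \<open>Taking the root of order \<open>e\<close> in the energy inequality bounds the
    derivative of \<open>keller (?V s)\<close> by a constant.\<close>
  have w_le: "w s * F (?V s) powr (- ((real N - 1) / (2 * real N - 1))) \<le> (e * c) powr (1 / e)"
    if s: "s \<in> {0..R}" for s
  proof -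
    have Fp: "F (?V s) > 0" using V[OF s] u0 b_pos by (intro F_pos) linarith
    have "w s = (w s powr e) powr (1 / e)"
      using w_nonneg[OF s] e(1) by (simp add: powr_powr)
    also have "\<dots> \<le> (e * c * F (?V s)) powr (1 / e)"
      using energy[OF s] e(1) w_nonneg[OF s] by (intro powr_mono2) (auto simp: field_simps)
    also have "\<dots> = (e * c) powr (1 / e) * F (?V s) powr (1 / e)"
      using e(1) c Fp by (simp add: powr_mult)
    finally have "w s * F (?V s) powr (- (1 / e))
        \<le> (e * c) powr (1 / e) * F (?V s) powr (1 / e) * F (?V s) powr (- (1 / e))"
      by (rule mult_right_mono) simp
    also have "\<dots> = (e * c) powr (1 / e)"
      using Fp by (simp add: powr_add[symmetric] mult.assoc)
    finally show ?thesis unfolding e(2) .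
  qed
  \<comment> \<open>Integrating this derivative bound over \<open>{0..r}\<close>; the factor
    \<open>r\<close> is at most 1.\<close>
  have "keller (?V r) - (e * c) powr (1 / e) * r \<le> keller (?V 0) - (e * c) powr (1 / e) * 0"
  proof (rule DERIV_nonpos_imp_decreasing_open[of 0 r])
    fix x assume x: "0 < x" "x < r"
    then have xR: "x \<in> {0..R}" using r by auto
    have "((\<lambda>s. keller (?V s)) has_real_derivative F (?V x) powr (- ((real N - 1) / (2 * real N - 1))) * w x) (at x)"
      using V[OF xR] u0 x r by (intro DERIV_chain2[OF keller_has_real_derivative dV]) auto
    note d = DERIV_diff[OF this DERIV_cmult_Id[of "(e * c) powr (1 / e)"]]
    show "\<exists>y. ((\<lambda>s. keller (?V s) - (e * c) powr (1 / e) * s) has_real_derivative y) (at x) \<and> y \<le> 0"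
      by (rule exI, rule conjI, rule d) (use w_le[OF xR] in \<open>simp add: mult.commute\<close>)
  next
    have "continuous_on {0..R} (\<lambda>s. keller (?V s))"
      using V u0
      by (intro continuous_on_compose2[OF DERIV_continuous_on[OF has_field_derivative_at_within[OF keller_has_real_derivative]] Vcont, of "{b<..}"])
         force+
    then show "continuous_on {0..r} (\<lambda>s. keller (?V s) - (e * c) powr (1 / e) * s)"
      using r by (intro continuous_intros) (auto intro: continuous_on_subset)
  qed (use r in auto)
  then have "keller (?V r) \<le> keller u\<^sub>0 + (e * c) powr (1 / e) * r"
    by (simp add: radial_map_0)
  also have "\<dots> \<le> keller u\<^sub>0 + (e * c) powr (1 / e) * 1"
    using r R by (intro add_left_mono mult_left_mono) auto
  finally show ?thesis by simp
qed

text \<open>The bound on \<open>keller\<close> depends on \<open>v\<close> not at all and on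
  \<open>R\<close> only through the maximum of \<open>K\<close> on \<open>{0..R}\<close>. Since
  \<open>keller\<close> tends to infinity, one \<open>B\<close> therefore serves every
  \<open>v\<close> lying below its own image.\<close>

lemma radial_map_locally_bounded:
  assumes u0: "u\<^sub>0 > b" and R: "R < 1"
  obtains B where "\<And>v r. continuous_on {0..<1} v \<Longrightarrow> (\<And>s. s \<in> {0..<1} \<Longrightarrow> v s > 0) \<Longrightarrow>
    (\<And>s. s \<in> {0..<1} \<Longrightarrow> v s \<le> radial_map u\<^sub>0 v s) \<Longrightarrow> r \<in> {0..R} \<Longrightarrow> radial_map u\<^sub>0 v r \<le> B"
proof (cases "R \<ge> 0")
  case True
  have "continuous_on {0..R} K" using R by (intro continuous_on_subset[OF K_cont]) auto
  then obtain s where "\<forall>r\<in>{0..R}. K r \<le> K s"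
    using continuous_attains_sup[of "{0..R}" K] True by auto
  then obtain M where M: "\<And>r. r \<in> {0..R} \<Longrightarrow> K r \<le> M" by blast
  define e where "e = (2 * real N - 1) / (real N - 1)"
  define c where "c = radial_const N * ((real N - 1) / real N) * M"
  have "eventually (\<lambda>t. keller t > keller u\<^sub>0 + (e * c) powr (1 / e)) at_top"
    using F_div unfolding filterlim_at_top_dense keller_def by blast
  then obtain B where B: "\<And>t. t \<ge> B \<Longrightarrow> keller t > keller u\<^sub>0 + (e * c) powr (1 / e)"
    by (auto simp: eventually_at_top_linorder)
  show thesis
  proof (rule that)
    fix v r assume "continuous_on {0..<1} v" "\<And>s. s \<in> {0..<1} \<Longrightarrow> v s > 0"
      "\<And>s. s \<in> {0..<1} \<Longrightarrow> v s \<le> radial_map u\<^sub>0 v s" "r \<in> {0..R}"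
    then have "keller (radial_map u\<^sub>0 v r) \<le> keller u\<^sub>0 + (e * c) powr (1 / e)"
      unfolding e_def c_def using u0 R M by (intro keller_radial_map_le) auto
    then show "radial_map u\<^sub>0 v r \<le> B" using B[of "radial_map u\<^sub>0 v r"] by linarith
  qed
qed (use that in auto)

end

subsection \<open>Existence and blow-up of radial profiles\<close>

context radial_problem
begin

lemma radial_map_fixed_point:
  assumes u0: "u\<^sub>0 > b"
  obtains u where "continuous_on {0..<1} u" "\<And>r. r \<in> {0..<1} \<Longrightarrow> u r \<ge> u\<^sub>0"
    "\<And>r. r \<in> {0..<1} \<Longrightarrow> u r = radial_map u\<^sub>0 u r"
proof -
  define U where "U n = (radial_map u\<^sub>0 ^^ n) (\<lambda>_. u\<^sub>0)" for n
  have U_Suc: "U (Suc n) = radial_map u\<^sub>0 (U n)" for n by (simp add: U_def)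
  have U: "continuous_on {0..<1} (U n) \<and> (\<forall>r\<in>{0..<1}. u\<^sub>0 \<le> U n r)" for n
  proof (induction n)
    case (Suc n)
    then have "\<And>r. r \<in> {0..<1} \<Longrightarrow> U n r > 0" using u0 b_pos by fastforce
    with Suc show ?case
      unfolding U_Suc using continuous_on_radial_map radial_map_ge by blast
  qed (simp add: U_def)
  have U_pos: "U n r > 0" if "r \<in> {0..<1}" for n r
    using U[of n] that u0 b_pos by fastforce
  \<comment> \<open>Each iterate lies below its image: the first step is
    \<open>radial_map_ge\<close> and the others follow from \<open>radial_map_mono\<close>. This is
    the hypothesis of the a priori bound.\<close>
  have U_le: "\<forall>r\<in>{0..<1}. U n r \<le> U (Suc n) r" for n
  proof (induction n)
    case 0
    then show ?case using U[of "Suc 0"] by (simp add: U_def)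
  next
    case (Suc n)
    then show ?case
      using U U_pos unfolding U_Suc[of "Suc n"] by (subst (1) U_Suc) (blast intro: radial_map_mono)
  qed
  have "\<exists>B. \<forall>r\<in>{0..R}. \<forall>n. U n r \<le> B" if R: "R < 1" for R
  proof -
    obtain B where B: "\<And>v r. continuous_on {0..<1} v \<Longrightarrow> (\<And>s. s \<in> {0..<1} \<Longrightarrow> v s > 0) \<Longrightarrow>
      (\<And>s. s \<in> {0..<1} \<Longrightarrow> v s \<le> radial_map u\<^sub>0 v s) \<Longrightarrow> r \<in> {0..R} \<Longrightarrow> radial_map u\<^sub>0 v r \<le> B"
      using radial_map_locally_bounded[OF u0 R] by metis
    have "U n r \<le> B" if r: "r \<in> {0..R}" for n r
    proof -
      have "U n r \<le> U (Suc n) r" using U_le r R by auto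
      also have "\<dots> \<le> B"
        using U U_pos U_le r unfolding U_Suc by (intro B) blast+
      finally show ?thesis .
    qed
    then show ?thesis by blast
  qed
  then obtain B where B: "\<And>R r n. R < 1 \<Longrightarrow> r \<in> {0..R} \<Longrightarrow> U n r \<le> B R"
    by metis
  define u where "u r = lim (\<lambda>n. U n r)" for r
  have u_lim: "(\<lambda>n. U n r) \<longlonglongrightarrow> u r" if r: "r \<in> {0..<1}" for r
  proof -
    have "incseq (\<lambda>n. U n r)" using U_le r by (intro incseq_SucI) blast
    moreover have "\<And>n. U n r \<le> B r" using B[of r r] r by auto
    ultimately show ?thesis
      unfolding u_def by (metis incseq_convergent limI)
  qed
  have u_ge: "u\<^sub>0 \<le> u r" if "r \<in> {0..<1}" for r
    using U that by (intro LIMSEQ_le_const[OF u_lim[OF that]]) auto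
  then have u_pos: "u r > 0" if "r \<in> {0..<1}" for r
    using that u0 b_pos by fastforce
  \<comment> \<open>The limit \<open>u\<close> is not yet known to be continuous, so the lemmas
    about \<open>radial_source\<close> do not apply to it. Dominated convergence is used twice,
    inside the radial mean and in the outer integral, and also supplies the integrability from which
    continuity of \<open>u\<close> is deduced afterwards.\<close>
  have fixed: "u r = radial_map u\<^sub>0 u r" "(\<lambda>t. t * slope u t) integrable_on {0..r}"
    if r: "r \<in> {0..<1}" for r
  proof -
    define m where "m = N - 1"
    have rsub: "s \<in> {0..<1}" if "s \<in> {0..r}" for s using that r by auto
    have src: "radial_source N (source (U n))" for n
      using U U_pos by (intro radial_source_source) blast+
    have "continuous_on {0..r} K" using r by (intro continuous_on_subset[OF K_cont]) auto
    then obtain s where s: "s \<in> {0..r}" "\<forall>x\<in>{0..r}. K x \<le> K s"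
      using continuous_attains_sup[of "{0..r}" K] r by auto
    \<comment> \<open>As \<open>f\<close> is nondecreasing, this constant dominates all sources on
      \<open>{0..r}\<close> at once; \<open>B r\<close> is the bound of the iterates on
      \<open>{0..r}\<close>.\<close>
    define D where "D = K s * f (B r)"
    have D: "source (U n) x \<le> D" if "x \<in> {0..r}" for n x
    proof -
      have "0 < U n x" "U n x \<le> B r" using U_pos[OF rsub[OF that]] B[of r x n] r that by auto
      then show ?thesis
        unfolding D_def using s that K_pos[OF rsub[OF that]] K_pos[OF rsub[OF s(1)]] f_pos[of "U n x"]
        by (intro mult_mono mono_onD[OF f_mono]) (auto simp: less_imp_le)
    qed
    have mean_lim: "(\<lambda>n. radial_mean m (source (U n)) t) \<longlonglongrightarrow> radial_mean m (source u) t"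
      if t: "t \<in> {0..r}" for t
      unfolding radial_mean_def
    proof (rule dominated_convergence(2)[where h = "\<lambda>_. D"])
      fix \<sigma> :: real assume \<sigma>: "\<sigma> \<in> {0..1}"
      then have t\<sigma>: "t * \<sigma> \<in> {0..r}" "t * \<sigma> \<in> {0..<1}"
        using mult_unit_interval[OF rsub[OF t] \<sigma>] t by auto
      fix n
      have "0 \<le> source (U n) (t * \<sigma>)"
        using radial_source.k_pos[OF src t\<sigma>(2)] less_imp_le by blast
      moreover have "\<sigma> ^ m * source (U n) (t * \<sigma>) \<le> 1 * D"
        using \<sigma> D[OF t\<sigma>(1), of n] calculation by (intro mult_mono) (auto simp: power_le_one)
      ultimately show "norm (\<sigma> ^ m * (K (t * \<sigma>) * f (U n (t * \<sigma>)))) \<le> D"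
        using \<sigma> by auto
    next
      fix \<sigma> :: real assume \<sigma>: "\<sigma> \<in> {0..1}"
      then have t\<sigma>: "t * \<sigma> \<in> {0..<1}" using mult_unit_interval[OF rsub[OF t] \<sigma>] by auto
      have "isCont f (u (t * \<sigma>))"
        using f_cont u_pos[OF t\<sigma>] by (auto simp: continuous_on_eq_continuous_at)
      from isCont_tendsto_compose[OF this u_lim[OF t\<sigma>]]
      show "(\<lambda>n. \<sigma> ^ m * (K (t * \<sigma>) * f (U n (t * \<sigma>)))) \<longlonglongrightarrow> \<sigma> ^ m * (K (t * \<sigma>) * f (u (t * \<sigma>)))"
        by (intro tendsto_mult tendsto_const)
    qed (auto intro!: integrable_continuous_real
        radial_mean_integrand_continuous[OF radial_source.k_cont[OF src] rsub[OF t]])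
    \<comment> \<open>The exponent \<open>(N - 1) / N\<close> is positive, so \<open>powr\<close>
      passes to the limit along nonnegative bases, without positivity of the limiting mean.\<close>
    have slope_lim: "(\<lambda>n. t * slope (U n) t) \<longlonglongrightarrow> t * slope u t" if t: "t \<in> {0..r}" for t
      unfolding radial_slope_def m_def[symmetric]
    proof (intro tendsto_mult tendsto_const tendsto_powr' mean_lim[OF t] disjI2 conjI always_eventually allI)
      show "0 \<le> radial_const N * radial_mean m (source (U n)) t" for n
        unfolding m_def using radial_source.A_pos[OF src rsub[OF t]] less_imp_le by blast
    qed (use N_ge_2 in auto)
    define E where "E = (radial_const N * (D / (real m + 1))) powr ((real N - 1) / real N)"
    have slope_le: "norm (t * slope (U n) t) \<le> E" if t: "t \<in> {0..r}" for n t
    proof -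
      have "radial_mean m (source (U n)) t \<le> radial_mean m (\<lambda>_. D) t"
        using D t radial_source.k_cont[OF src] rsub[OF t] by (intro radial_mean_mono) auto
      then have "slope (U n) t \<le> E"
        unfolding E_def radial_slope_def m_def[symmetric] radial_mean_const
        using radial_source.A_pos[OF src rsub[OF t], of n] radial_const_pos[OF N_ge_2] N_ge_2
        by (intro powr_mono2 mult_left_mono) (auto simp: m_def)
      moreover have "0 < slope (U n) t" using radial_source.slope_pos[OF src rsub[OF t]] .
      moreover have "t * slope (U n) t \<le> 1 * slope (U n) t"
        using rsub[OF t] calculation(2) by (intro mult_right_mono) auto
      ultimately have "t * slope (U n) t \<le> E" "0 \<le> t * slope (U n) t" using t by (linarith, simp)
      then show ?thesis by simp
    qed
    have int: "(\<lambda>t. t * slope (U n) t) integrable_on {0..r}" for n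
      using r by (intro integrable_continuous_real continuous_on_mult continuous_on_id
          continuous_on_subset[OF radial_source.continuous_on_slope[OF src]]) auto
    show "(\<lambda>t. t * slope u t) integrable_on {0..r}"
      by (rule dominated_convergence(1)[OF int _ slope_le slope_lim]) auto
    have "(\<lambda>n. integral {0..r} (\<lambda>t. t * slope (U n) t)) \<longlonglongrightarrow> integral {0..r} (\<lambda>t. t * slope u t)"
      by (rule dominated_convergence(2)[OF int _ slope_le slope_lim]) auto
    then have "(\<lambda>n. U (Suc n) r) \<longlonglongrightarrow> radial_map u\<^sub>0 u r"
      unfolding U_Suc radial_map_def by (intro tendsto_add tendsto_const)
    moreover have "(\<lambda>n. U (Suc n) r) \<longlonglongrightarrow> u r"
      using u_lim[OF r] by (rule LIMSEQ_Suc)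
    ultimately show "u r = radial_map u\<^sub>0 u r" by (metis LIMSEQ_unique)
  qed
  \<comment> \<open>By the fixed point equation \<open>u\<close> is a constant plus an indefinite
    integral.\<close>
  have "continuous_on {0..<1} u"
    unfolding continuous_on_eq_continuous_within
  proof
    fix r :: real assume r: "r \<in> {0..<1}"
    define R where "R = (1 + r) / 2"
    have R: "r < R" "R < 1" "R \<in> {0..<1}" using r by (auto simp: R_def)
    have "continuous_on {0..R} (\<lambda>r. u\<^sub>0 + integral {0..r} (\<lambda>t. t * slope u t))"
      by (intro continuous_intros indefinite_integral_continuous_1 fixed(2) R)
    then have "continuous_on {0..R} u"
      by (rule continuous_on_eq) (use fixed(1) R in \<open>auto simp: radial_map_def\<close>)
    then have "continuous (at r within {0..R}) u"
      using r R by (auto simp: continuous_on_eq_continuous_within)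
    moreover have "at r within {0..R} = at r within {0..<1}"
      by (rule at_within_nhd[of _ "{..<R}"]) (use r R in auto)
    ultimately show "continuous (at r within {0..<1}) u" by simp
  qed
  then show thesis using that u_ge fixed(1) by blast
qed

end

section \<open>Blow-up at the boundary from the class of \<open>p\<close>\<close>

lemma P_fun_nonneg:
  assumes "\<And>t. t > 0 \<Longrightarrow> p t > 0" "0 < \<tau>" "\<tau> \<le> 1"
  shows "P_fun p \<tau> \<ge> 0"
  unfolding P_fun_def using assms
  by (auto simp: interval_lebesgue_integral_def set_lebesgue_integral_def less_imp_le
      intro!: integral_nonneg_AE AE_I2 split: split_indicator)

lemma P_fun_powr_LBINT_has_real_derivative:
  assumes p: "continuous_on {0<..} p" "\<And>t. t > 0 \<Longrightarrow> p t > 0" and q: "q > 0" and \<tau>: "0 < \<tau>" "\<tau> < 1"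
  shows "((\<lambda>\<delta>. LBINT \<tau>=ereal \<delta>..ereal 1. P_fun p \<tau> powr q) has_real_derivative - (P_fun p \<tau> powr q)) (at \<tau>)"
proof -
  have pc: "continuous_on {\<tau>/2..1} p" using \<tau> by (intro continuous_on_subset[OF p(1)]) auto
  have "continuous_on {\<tau>/2..1} (\<lambda>x. integral {x..1} p)"
    by (intro indefinite_integral_continuous_1' integrable_continuous_real pc)
  then have "continuous_on {\<tau>/2..1} (P_fun p)"
  proof (rule continuous_on_eq)
    fix x assume "x \<in> {\<tau>/2..1}"
    then show "integral {x..1} p = P_fun p x"
      unfolding P_fun_def by (intro LBINT_eq_integral[symmetric] continuous_on_subset[OF pc]) auto
  qed
  then have "continuous_on {\<tau>/2..1} (\<lambda>x. P_fun p x powr q)"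
    using P_fun_nonneg[OF p(2)] q \<tau> by (intro continuous_on_powr' continuous_on_const) auto
  then show ?thesis using \<tau> by (intro LBINT_has_real_derivative_lower[of "\<tau>/2"]) auto
qed

context radial_problem
begin

text \<open>Two successive comparisons of derivatives. Near 1 the source is at least
  \<open>c * p (1 - r) * f u\<^sub>0\<close>, so its weighted integral \<open>\<Phi>\<close>
  dominates a multiple of \<open>P_fun p (1 - r)\<close>. Inserting this into \<open>slope\<close>
  bounds \<open>u'\<close> below by a multiple of \<open>P_fun p (1 - r) powr q\<close>, and the
  integral \<open>J\<close> of this power diverges.\<close>

lemma radial_fixed_point_blow_up:
  assumes u: "continuous_on {0..<1} u" "\<And>r. r \<in> {0..<1} \<Longrightarrow> u r \<ge> u\<^sub>0"
    and u': "\<And>r. r \<in> {0<..<1} \<Longrightarrow> (u has_real_derivative r * slope u r) (at r)"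
    and u0: "u\<^sub>0 > 0"
    and p: "p \<in> class_P_infinity N" and c: "c > 0"
    and Kp: "\<forall>\<^sub>F r in at_left 1. c * p (1 - r) \<le> K r"
  shows "filterlim u at_top (at_left 1)"
proof -
  have pc: "continuous_on {0<..} p" and pp: "\<And>t. t > 0 \<Longrightarrow> p t > 0"
    using p C1_differentiable_imp_continuous_on unfolding class_P_infinity_def by auto
  define q where "q = (real N - 1) / real N"
  have q: "q > 0" using N_ge_2 by (simp add: q_def)
  define J where "J \<delta> = (LBINT \<tau>=ereal \<delta>..ereal 1. P_fun p \<tau> powr q)" for \<delta>
  have J_lim: "filterlim J at_top (at_right 0)"
    using p unfolding class_P_infinity_def J_def[abs_def] q_def by auto
  have up: "u r > 0" if "r \<in> {0..<1}" for r using u(2)[OF that] u0 by simp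
  interpret radial_source N "source u" by (rule radial_source_source[OF u(1) up])
  from Kp obtain r0 where r0: "r0 < 1" "\<And>r. r0 < r \<Longrightarrow> r < 1 \<Longrightarrow> c * p (1 - r) \<le> K r"
    by (auto simp: eventually_at_left_field)
  \<comment> \<open>A starting point beyond \<open>r0\<close> that is also positive, so that
    \<open>r1 ^ (N - 1)\<close> and \<open>r1\<close> are usable lower bounds for the
    weights.\<close>
  define r1 where "r1 = (1 + max r0 0) / 2"
  have r1: "r0 < r1" "0 < r1" "r1 < 1" using r0 by (auto simp: r1_def)
  define \<Phi> where "\<Phi> r = r ^ N * radial_mean (N - 1) (source u) r" for r
  define \<kappa> where "\<kappa> = r1 ^ (N - 1) * (c * f u\<^sub>0)"
  \<comment> \<open>The first entry gives the comparison of derivatives beyond \<open>r1\<close>,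
    the second the comparison of values at \<open>r1\<close>. Adding 1 keeps the denominator
    positive.\<close>
  define \<epsilon> where "\<epsilon> = min \<kappa> (\<Phi> r1 / (P_fun p (1 - r1) + 1))"
  have "\<Phi> r1 > 0"
    unfolding \<Phi>_def using r1 by (intro mult_pos_pos radial_mean_pos k_cont k_pos) auto
  have P1: "P_fun p (1 - r1) \<ge> 0" using r1 pp by (intro P_fun_nonneg) auto
  have \<epsilon>: "\<epsilon> > 0" "\<epsilon> \<le> \<kappa>" "\<epsilon> * P_fun p (1 - r1) \<le> \<Phi> r1"
  proof -
    show "\<epsilon> > 0" "\<epsilon> \<le> \<kappa>"
      using r1 c f_pos[OF u0] \<open>\<Phi> r1 > 0\<close> P1 by (auto simp: \<epsilon>_def \<kappa>_def)
    have "\<epsilon> * P_fun p (1 - r1) \<le> \<epsilon> * (P_fun p (1 - r1) + 1)"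
      using \<open>\<epsilon> > 0\<close> by (intro mult_left_mono) auto
    also have "\<dots> \<le> \<Phi> r1 / (P_fun p (1 - r1) + 1) * (P_fun p (1 - r1) + 1)"
      using P1 by (intro mult_right_mono) (auto simp: \<epsilon>_def)
    also have "\<dots> = \<Phi> r1" using P1 by simp
    finally show "\<epsilon> * P_fun p (1 - r1) \<le> \<Phi> r1" .
  qed
  have \<Phi>_deriv: "(\<Phi> has_real_derivative x ^ (N - 1) * source u x) (at x)" if x: "x \<in> {0<..<1}" for x
  proof -
    have "((\<lambda>x. x ^ Suc (N - 1) * radial_mean (N - 1) (source u) x) has_real_derivative
       (1 + real (N - 1)) * (1 * x ^ (N - 1)) * radial_mean (N - 1) (source u) x +
       (source u x - (real (N - 1) + 1) * radial_mean (N - 1) (source u) x) / x * x ^ Suc (N - 1)) (at x)"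
      by (intro DERIV_mult DERIV_power_Suc DERIV_ident radial_mean_has_real_derivative k_cont x)
    moreover have "(1 + real (N - 1)) * (1 * x ^ (N - 1)) * radial_mean (N - 1) (source u) x +
       (source u x - (real (N - 1) + 1) * radial_mean (N - 1) (source u) x) / x * x ^ Suc (N - 1)
       = x ^ (N - 1) * source u x"
    proof -
      have "d / x * x ^ Suc (N - 1) = d * x ^ (N - 1)" for d :: real using x by simp
      then show ?thesis by (simp only:) (simp add: algebra_simps)
    qed
    ultimately show ?thesis
      using N_ge_2 unfolding \<Phi>_def[abs_def] by (simp add: Suc_diff_Suc numeral_2_eq_2)
  qed
  have \<Phi>_ge: "\<epsilon> * P_fun p (1 - r) \<le> \<Phi> r" if r: "r1 \<le> r" "r < 1" for r
  proof -
    have "\<Phi> r1 - \<epsilon> * P_fun p (1 - r1) \<le> \<Phi> r - \<epsilon> * P_fun p (1 - r)"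
    proof (rule DERIV_nonneg_imp_nondecreasing[OF r(1)])
      fix x assume x: "r1 \<le> x" "x \<le> r"
      then have x1: "x \<in> {0<..<1}" "x \<in> {0..<1}" "r0 < x" using r r1 by auto
      have "(P_fun p has_real_derivative - p (1 - x)) (at (1 - x))"
        unfolding P_fun_def[abs_def] using x1
        by (intro LBINT_has_real_derivative_lower[of "(1 - x) / 2"] continuous_on_subset[OF pc]) auto
      then have "((\<lambda>x. P_fun p (1 - x)) has_real_derivative - p (1 - x) * - 1) (at x)"
        by (rule DERIV_chain2) (auto intro!: derivative_eq_intros)
      then have "((\<lambda>x. \<Phi> x - \<epsilon> * P_fun p (1 - x)) has_real_derivative
          x ^ (N - 1) * source u x - \<epsilon> * (- p (1 - x) * - 1)) (at x)"
        by (intro DERIV_diff DERIV_cmult \<Phi>_deriv x1)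
      moreover have "\<epsilon> * p (1 - x) \<le> x ^ (N - 1) * source u x"
      proof -
        have px: "p (1 - x) > 0" using pp x1 by simp
        have "\<epsilon> * p (1 - x) \<le> \<kappa> * p (1 - x)" using \<epsilon> px by simp
        also have "\<dots> = r1 ^ (N - 1) * ((c * p (1 - x)) * f u\<^sub>0)" by (simp add: \<kappa>_def)
        also have "\<dots> \<le> x ^ (N - 1) * (K x * f (u x))"
          using x r1 c px r0(2)[of x] x1 u(2)[OF x1(2)] u0 f_pos[OF u0]
          by (intro mult_mono power_mono mono_onD[OF f_mono]) (auto simp: K_pos less_imp_le)
        finally show ?thesis .
      qed
      ultimately show "\<exists>y. ((\<lambda>x. \<Phi> x - \<epsilon> * P_fun p (1 - x)) has_real_derivative y) (at x) \<and> 0 \<le> y"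
        by auto
    qed
    then show ?thesis using \<epsilon>(3) by simp
  qed
  \<comment> \<open>From \<open>\<Phi> \<le> radial_mean\<close>, valid because
    \<open>x ^ N \<le> 1\<close>, the slope is at least
    \<open>(radial_const N * \<epsilon> * P_fun p (1 - x)) powr q\<close>; the factor
    \<open>r1\<close> bounds the \<open>x\<close> in \<open>u' = x * slope u x\<close> from
    below.\<close>
  define \<mu> where "\<mu> = r1 * (radial_const N * \<epsilon>) powr q"
  have \<mu>: "\<mu> > 0" using r1 \<epsilon>(1) radial_const_pos[OF N_ge_2] by (auto simp: \<mu>_def)
  have u_ge: "u r1 - \<mu> * J (1 - r1) + \<mu> * J (1 - r) \<le> u r" if r: "r1 \<le> r" "r < 1" for r
  proof -
    have "u r1 - \<mu> * J (1 - r1) \<le> u r - \<mu> * J (1 - r)"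
    proof (rule DERIV_nonneg_imp_nondecreasing[OF r(1)])
      fix x assume x: "r1 \<le> x" "x \<le> r"
      then have x1: "x \<in> {0<..<1}" "x \<in> {0..<1}" using r r1 by auto
      have "(J has_real_derivative - (P_fun p (1 - x) powr q)) (at (1 - x))"
        unfolding J_def[abs_def] using x1
        by (intro P_fun_powr_LBINT_has_real_derivative pc pp q) auto
      then have "((\<lambda>x. J (1 - x)) has_real_derivative - (P_fun p (1 - x) powr q) * - 1) (at x)"
        by (rule DERIV_chain2) (auto intro!: derivative_eq_intros)
      then have "((\<lambda>x. u x - \<mu> * J (1 - x)) has_real_derivative
          x * slope u x - \<mu> * (- (P_fun p (1 - x) powr q) * - 1)) (at x)"
        by (intro DERIV_diff DERIV_cmult u' x1)
      moreover have "\<mu> * P_fun p (1 - x) powr q \<le> x * slope u x"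
      proof -
        have P: "P_fun p (1 - x) \<ge> 0" using x1 pp by (intro P_fun_nonneg) auto
        have mp: "radial_mean (N - 1) (source u) x > 0"
          by (intro radial_mean_pos k_cont k_pos x1)
        have "\<epsilon> * P_fun p (1 - x) \<le> \<Phi> x" using \<Phi>_ge x r by simp
        also have "\<dots> \<le> 1 * radial_mean (N - 1) (source u) x"
          unfolding \<Phi>_def using x1 mp by (intro mult_right_mono) (auto simp: power_le_one)
        finally have "radial_const N * (\<epsilon> * P_fun p (1 - x)) \<le> A x"
          using radial_const_pos[OF N_ge_2] by simp
        then have "(radial_const N * \<epsilon> * P_fun p (1 - x)) powr q \<le> slope u x"
          unfolding radial_slope_def q_def[symmetric] using q P \<epsilon>(1) radial_const_pos[OF N_ge_2]
          by (intro powr_mono2) (auto simp: mult.assoc)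
        moreover have "(radial_const N * \<epsilon> * P_fun p (1 - x)) powr q
            = (radial_const N * \<epsilon>) powr q * P_fun p (1 - x) powr q"
          using P \<epsilon>(1) radial_const_pos[OF N_ge_2] by (intro powr_mult)
        ultimately have "r1 * ((radial_const N * \<epsilon>) powr q * P_fun p (1 - x) powr q) \<le> x * slope u x"
          using x r1 by (intro mult_mono) auto
        then show ?thesis by (simp add: \<mu>_def)
      qed
      ultimately show "\<exists>y. ((\<lambda>x. u x - \<mu> * J (1 - x)) has_real_derivative y) (at x) \<and> 0 \<le> y"
        by auto
    qed
    then show ?thesis by simp
  qed
  have "filterlim (\<lambda>r::real. 1 - r) (at_right 0) (at_left 1)"
    unfolding filterlim_at by (auto intro!: tendsto_eq_intros simp: eventually_at_filter)
  from filterlim_compose[OF J_lim this]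
  have "filterlim (\<lambda>r. (u r1 - \<mu> * J (1 - r1)) + \<mu> * J (1 - r)) at_top (at_left 1)"
    by (intro filterlim_tendsto_add_at_top[OF tendsto_const]
        filterlim_tendsto_pos_mult_at_top[OF tendsto_const \<mu>])
  then show ?thesis
  proof (rule filterlim_at_top_mono)
    show "\<forall>\<^sub>F r in at_left 1. u r1 - \<mu> * J (1 - r1) + \<mu> * J (1 - r) \<le> u r"
      unfolding eventually_at_left_field using r1 u_ge by (auto intro!: exI[of _ r1])
  qed
qed

end

subsection \<open>From radial profiles to solutions in the ball\<close>

text \<open>An orthogonal \<open>Q\<close> carrying \<open>axis k (norm x)\<close> to
  \<open>x\<close> diagonalises the matrix: it acts as
  \<open>\<alpha> - \<beta> * (x \<bullet> x)\<close> along \<open>x\<close> and as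
  \<open>\<alpha>\<close> on the orthogonal complement.\<close>

lemma det_scaled_identity_minus_rank_one:
  fixes x :: "real^'n"
  shows "det (\<chi> i j. (if i = j then \<alpha> else 0) - \<beta> * x $ i * x $ j)
    = \<alpha> ^ (CARD('n) - 1) * (\<alpha> - \<beta> * (x \<bullet> x))" (is "det ?M = _")
proof -
  fix k :: 'n
  have "\<exists>Q :: real^'n^'n. orthogonal_matrix Q \<and> Q *v axis k (norm x) = x"
  proof (cases "x = 0")
    case True
    then show ?thesis using orthogonal_matrix_id by (intro exI[of _ "mat 1"]) (auto simp: axis_def vec_eq_iff)
  next
    case False
    then have "norm (x /\<^sub>R norm x) = 1" by simp
    then obtain Q :: "real^'n^'n" where Q: "orthogonal_matrix Q" "Q *v axis k 1 = x /\<^sub>R norm x"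
      using orthogonal_matrix_exists_basis by metis
    have "axis k (norm x) = norm x *\<^sub>R axis k (1::real)" by (simp add: axis_def vec_eq_iff)
    then have "Q *v axis k (norm x) = norm x *\<^sub>R (x /\<^sub>R norm x)"
      using Q(2) by (metis matrix_vector_mult_scaleR)
    then show ?thesis using Q(1) False by (intro exI[of _ Q]) simp
  qed
  then obtain Q :: "real^'n^'n" where Q: "orthogonal_matrix Q" "Q *v axis k (norm x) = x" by blast
  \<comment> \<open>Column \<open>k\<close> of \<open>Q\<close> is the direction of
    \<open>x\<close>, so the rank-one part can be written with this column, and orthonormality of
    the columns evaluates \<open>?M ** Q\<close>.\<close>
  have xQ: "x $ i = norm x * Q $ i $ k" for i
  proof -
    have "(Q *v axis k (norm x)) $ i = (\<Sum>j\<in>UNIV. Q $ i $ j * (if j = k then norm x else 0))"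
      by (simp add: matrix_vector_mult_def axis_def)
    also have "\<dots> = (\<Sum>j\<in>UNIV. if j = k then Q $ i $ j * norm x else 0)"
      by (intro sum.cong) auto
    finally show ?thesis using Q(2) by (simp add: mult.commute)
  qed
  have orth: "(\<Sum>l\<in>UNIV. Q $ l $ i * Q $ l $ j) = (if i = j then 1 else 0)" for i j
  proof -
    have "(transpose Q ** Q) $ i $ j = (mat 1 :: real^'n^'n) $ i $ j"
      using Q(1) by (simp add: orthogonal_matrix)
    then show ?thesis by (simp add: matrix_matrix_mult_def transpose_def mat_def)
  qed
  define D :: "real^'n^'n" where
    "D = (\<chi> i j. if i = j then (if j = k then \<alpha> - \<beta> * (x \<bullet> x) else \<alpha>) else 0)"
  have "?M ** Q = Q ** D"
  proof -
    have "(\<Sum>l\<in>UNIV. ((if i = l then \<alpha> else 0) - \<beta> * x $ i * x $ l) * Q $ l $ j)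
        = (\<Sum>l\<in>UNIV. Q $ i $ l * D $ l $ j)" for i j
    proof -
      have "(\<Sum>l\<in>UNIV. ((if i = l then \<alpha> else 0) - \<beta> * x $ i * x $ l) * Q $ l $ j)
          = (\<Sum>l\<in>UNIV. (if i = l then \<alpha> * Q $ l $ j else 0)
             - \<beta> * (norm x)\<^sup>2 * Q $ i $ k * (Q $ l $ k * Q $ l $ j))"
      proof (intro sum.cong refl)
        fix l
        have "x $ i * x $ l = (norm x)\<^sup>2 * Q $ i $ k * Q $ l $ k"
          unfolding xQ[of i] xQ[of l] power2_eq_square by (simp only: mult_ac)
        then have off_diag: "\<beta> * x $ i * x $ l * Q $ l $ j = \<beta> * (norm x)\<^sup>2 * Q $ i $ k * (Q $ l $ k * Q $ l $ j)"
          by (simp only: mult.assoc)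
        have diag: "(if i = l then \<alpha> else 0) * Q $ l $ j = (if i = l then \<alpha> * Q $ l $ j else 0)" by simp
        show "((if i = l then \<alpha> else 0) - \<beta> * x $ i * x $ l) * Q $ l $ j =
            (if i = l then \<alpha> * Q $ l $ j else 0) - \<beta> * (norm x)\<^sup>2 * Q $ i $ k * (Q $ l $ k * Q $ l $ j)"
          unfolding left_diff_distrib diag off_diag ..
      qed
      also have "\<dots> = \<alpha> * Q $ i $ j - \<beta> * (norm x)\<^sup>2 * Q $ i $ k * (if k = j then 1 else 0)"
        by (simp add: sum_subtractf sum_distrib_left[symmetric] orth)
      also have "\<dots> = Q $ i $ j * D $ j $ j"
        by (simp add: D_def power2_norm_eq_inner algebra_simps)
      also have "\<dots> = (\<Sum>l\<in>UNIV. if l = j then Q $ i $ l * D $ l $ j else 0)" by simp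
      also have "\<dots> = (\<Sum>l\<in>UNIV. Q $ i $ l * D $ l $ j)"
        by (intro sum.cong) (auto simp: D_def)
      finally show ?thesis .
    qed
    then show ?thesis by (simp add: matrix_matrix_mult_def vec_eq_iff)
  qed
  then have "det ?M * det Q = det Q * det D" by (simp only: det_mul[symmetric])
  moreover have "det Q \<noteq> 0" using det_orthogonal_matrix[OF Q(1)] by auto
  ultimately have "det ?M = det D" by simp
  also have "\<dots> = (\<Prod>i\<in>UNIV. D $ i $ i)" by (rule det_diagonal) (simp add: D_def)
  also have "\<dots> = D $ k $ k * (\<Prod>i\<in>UNIV - {k}. D $ i $ i)" by (rule prod.remove) auto
  also have "(\<Prod>i\<in>UNIV - {k}. D $ i $ i) = (\<Prod>i\<in>UNIV - {k}. \<alpha>)"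
    by (intro prod.cong) (auto simp: D_def)
  finally show ?thesis by (simp add: D_def card_Diff_singleton)
qed

text \<open>The quadratic form is \<open>\<alpha> * (v \<bullet> v) - \<beta> * (x \<bullet>
  v)\<^sup>2\<close>. For \<open>\<beta> \<le> 0\<close> it is at least
  \<open>\<alpha> * (v \<bullet> v)\<close>; otherwise Cauchy-Schwarz reduces it to the second
  assumption.\<close>

lemma positive_definite_scaled_identity_minus_rank_one:
  fixes x :: "real^'n"
  assumes \<alpha>: "\<alpha> > 0" "\<alpha> - \<beta> * (x \<bullet> x) > 0"
  shows "positive_definite (\<chi> i j. (if i = j then \<alpha> else 0) - \<beta> * x $ i * x $ j)" (is "positive_definite ?M")
  unfolding positive_definite_def
proof (intro conjI allI impI)
  show "transpose ?M = ?M" by (simp add: transpose_def vec_eq_iff)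
  fix v :: "real^'n" assume v: "v \<noteq> 0"
  have "?M *v v = \<alpha> *\<^sub>R v - (\<beta> * (x \<bullet> v)) *\<^sub>R x"
  proof -
    have "(\<Sum>j\<in>UNIV. ((if i = j then \<alpha> else 0) - \<beta> * x $ i * x $ j) * v $ j)
        = \<alpha> * v $ i - \<beta> * (x \<bullet> v) * x $ i" for i
    proof -
      have "(\<Sum>j\<in>UNIV. ((if i = j then \<alpha> else 0) - \<beta> * x $ i * x $ j) * v $ j)
          = (\<Sum>j\<in>UNIV. (if i = j then \<alpha> * v $ j else 0) - \<beta> * x $ i * (x $ j * v $ j))"
        by (intro sum.cong) (auto simp: algebra_simps)
      also have "\<dots> = \<alpha> * v $ i - \<beta> * x $ i * (x \<bullet> v)"
        by (simp add: sum_subtractf sum_distrib_left[symmetric] inner_vec_def)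
      finally show ?thesis by simp
    qed
    then show ?thesis by (simp add: matrix_vector_mult_def vec_eq_iff)
  qed
  then have eq: "v \<bullet> (?M *v v) = \<alpha> * (v \<bullet> v) - \<beta> * (x \<bullet> v)\<^sup>2"
    by (simp add: inner_diff_right inner_commute power2_eq_square)
  have vv: "v \<bullet> v > 0" using v by simp
  show "v \<bullet> (?M *v v) > 0"
  proof (cases "\<beta> \<le> 0")
    case True
    then have "\<beta> * (x \<bullet> v)\<^sup>2 \<le> 0" by (simp add: mult_nonpos_nonneg)
    then show ?thesis using eq mult_pos_pos[OF \<alpha>(1) vv] by linarith
  next
    case False
    then have "\<beta> * (x \<bullet> v)\<^sup>2 \<le> \<beta> * ((x \<bullet> x) * (v \<bullet> v))"
      by (intro mult_left_mono Cauchy_Schwarz_ineq) auto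
    then show ?thesis using eq mult_pos_pos[OF \<alpha>(2) vv] by (simp add: algebra_simps)
  qed
qed

text \<open>Here \<open>h\<close> is \<open>u' / r\<close> and \<open>g\<close> is
  \<open>r h'\<close>, so the Hessian of \<open>z\<close> is \<open>h\<close> times the identity
  plus \<open>g / (norm x)\<^sup>2\<close> times the rank-one matrix of \<open>x\<close>. Continuity
  of \<open>g\<close> with \<open>g 0 = 0\<close> keeps it continuous at the origin, where the
  quotient is 0 by the convention for division by 0.\<close>

locale radial_function =
  fixes u h g :: "real \<Rightarrow> real" and z :: "real^'n \<Rightarrow> real"
  assumes u_deriv: "\<And>r. r \<in> {0..<1} \<Longrightarrow> (u has_real_derivative r * h r) (at r within {0..<1})"
    and h_deriv: "\<And>r. r \<in> {0<..<1} \<Longrightarrow> (h has_real_derivative g r / r) (at r)"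
    and h_cont: "continuous_on {0..<1} h"
    and g_cont: "continuous_on {0..<1} g" and g_0: "g 0 = 0"
    and z_eq: "\<And>x. x \<in> ball 0 1 \<Longrightarrow> z x = u (norm x)"
begin

lemma radial_has_derivative:
  assumes x: "x \<in> ball 0 1"
  shows "(z has_derivative (\<lambda>v. h (norm x) * (x \<bullet> v))) (at x)"
proof (cases "x = 0")
  case True
  \<comment> \<open>At the origin the gradient is 0, because the one-sided derivative of
    \<open>u\<close> at 0 is \<open>0 * h 0\<close>.\<close>
  have "((\<lambda>r. (u r - u 0) / (r - 0)) \<longlongrightarrow> 0) (at 0 within {0..<1})"
    using u_deriv[of 0] by (simp add: has_field_derivative_iff)
  moreover have "filterlim norm (at 0 within {0..<1}) (at (0 :: real^'n))"
    unfolding filterlim_at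
  proof
    show "\<forall>\<^sub>F y :: real^'n in at 0. norm y \<in> {0..<1} \<and> norm y \<noteq> 0"
      by (auto simp: eventually_at dist_norm intro!: exI[of _ 1])
  qed (intro tendsto_norm_zero tendsto_ident_at)
  ultimately have "((\<lambda>y :: real^'n. (u (norm y) - u 0) / (norm y - 0)) \<longlongrightarrow> 0) (at 0)"
    by (rule filterlim_compose)
  from tendsto_norm[OF this]
  have "((\<lambda>y. norm (z y - z 0 - 0) / norm (y - 0)) \<longlongrightarrow> 0) (at 0)"
  proof (rule Lim_transform_eventually[OF tendsto_eq_rhs])
    show "\<forall>\<^sub>F y in at 0. norm ((u (norm y) - u 0) / (norm y - 0)) = norm (z y - z 0 - 0) / norm (y - 0)"
      by (auto simp: eventually_at dist_norm z_eq intro!: exI[of _ 1])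
  qed simp
  then show ?thesis using True by (simp add: has_derivative_iff_norm bounded_linear_zero)
next
  case False
  then have r: "norm x \<in> {0<..<1}" using x by auto
  have "(u has_real_derivative norm x * h (norm x)) (at (norm x))"
    using r by (intro DERIV_within_unit u_deriv) auto
  from has_derivative_compose[OF has_derivative_norm[OF False] this[unfolded has_field_derivative_def]]
  have "((\<lambda>y. u (norm y)) has_derivative (\<lambda>v. norm x * h (norm x) * (sgn x \<bullet> v))) (at x)"
    by (simp add: inner_commute)
  moreover have "norm x * h (norm x) * (sgn x \<bullet> v) = h (norm x) * (x \<bullet> v)" for v
    using False by (simp add: sgn_div_norm)
  ultimately have "((\<lambda>y. u (norm y)) has_derivative (\<lambda>v. h (norm x) * (x \<bullet> v))) (at x)" by simp
  then show ?thesis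
    by (rule has_derivative_transform_within_open[OF _ open_ball x]) (simp add: z_eq)
qed

lemma radial_partial_deriv: "x \<in> ball 0 1 \<Longrightarrow> partial_deriv j z x = h (norm x) * x $ j"
  unfolding partial_deriv_def frechet_derivative_at[OF radial_has_derivative, symmetric]
  by (simp add: inner_axis)

lemma radial_partial_has_derivative:
  assumes x: "x \<in> ball 0 1"
  shows "(partial_deriv j z has_derivative
    (\<lambda>v. h (norm x) * v $ j + g (norm x) / (norm x)\<^sup>2 * (x \<bullet> v) * x $ j)) (at x)"
proof (cases "x = 0")
  case True
  have "(h \<longlongrightarrow> h 0) (at 0 within {0..<1})"
    using h_cont by (auto simp: continuous_on_def)
  moreover have "filterlim norm (at 0 within {0..<1}) (at (0 :: real^'n))"
    unfolding filterlim_at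
  proof
    show "\<forall>\<^sub>F y :: real^'n in at 0. norm y \<in> {0..<1} \<and> norm y \<noteq> 0"
      by (auto simp: eventually_at dist_norm intro!: exI[of _ 1])
  qed (intro tendsto_norm_zero tendsto_ident_at)
  ultimately have "((\<lambda>y :: real^'n. h (norm y)) \<longlongrightarrow> h 0) (at 0)"
    by (rule filterlim_compose)
  then have "((\<lambda>y :: real^'n. h (norm y) - h 0) \<longlongrightarrow> 0) (at 0)" by (simp add: LIM_zero_iff)
  then have lim: "((\<lambda>y :: real^'n. norm (h (norm y) - h 0)) \<longlongrightarrow> 0) (at 0)" by (rule tendsto_norm_zero)
  \<comment> \<open>Since \<open>partial_deriv j z y = h (norm y) * y $ j\<close>, the linearisation
    error is \<open>(h (norm y) - h 0) * y $ j\<close>, which continuity of \<open>h\<close> makes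
    small relative to \<open>norm y\<close>.\<close>
  have "((\<lambda>y. norm (partial_deriv j z y - partial_deriv j z 0 - h 0 * (y - 0) $ j) / norm (y - 0)) \<longlongrightarrow> 0) (at 0)"
  proof (rule Lim_null_comparison[OF _ lim])
    have "norm (norm (partial_deriv j z y - partial_deriv j z 0 - h 0 * (y - 0) $ j) / norm (y - 0))
        \<le> norm (h (norm y) - h 0)" if y: "y \<noteq> 0" "y \<in> ball 0 1" for y
    proof -
      have "partial_deriv j z y - partial_deriv j z 0 - h 0 * (y - 0) $ j = (h (norm y) - h 0) * y $ j"
        using y by (simp add: radial_partial_deriv algebra_simps)
      moreover have "\<bar>h (norm y) - h 0\<bar> * \<bar>y $ j\<bar> \<le> \<bar>h (norm y) - h 0\<bar> * norm y"
        by (intro mult_left_mono component_le_norm_cart) auto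
      ultimately show ?thesis using y by (simp add: abs_mult divide_le_eq)
    qed
    then show "\<forall>\<^sub>F y in at 0. norm (norm (partial_deriv j z y - partial_deriv j z 0 - h 0 * (y - 0) $ j) / norm (y - 0))
        \<le> norm (h (norm y) - h 0)"
      by (auto simp: eventually_at dist_norm intro!: exI[of _ 1])
  qed
  moreover have "bounded_linear (\<lambda>v :: real^'n. h 0 * v $ j)"
    by (intro bounded_linear_const_mult bounded_linear_vec_nth)
  ultimately show ?thesis using True by (simp add: has_derivative_iff_norm g_0)
next
  case False
  then have r: "norm x \<in> {0<..<1}" using x by auto
  have "((\<lambda>y. h (norm y)) has_derivative (\<lambda>v. g (norm x) / norm x * (sgn x \<bullet> v))) (at x)"
    using has_derivative_compose[OF has_derivative_norm[OF False] h_deriv[OF r, unfolded has_field_derivative_def]]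
    by (simp add: inner_commute)
  from has_derivative_mult[OF this bounded_linear_imp_has_derivative[OF bounded_linear_vec_nth]]
  have "((\<lambda>y. h (norm y) * y $ j) has_derivative
      (\<lambda>v. h (norm x) * v $ j + g (norm x) / norm x * (sgn x \<bullet> v) * x $ j)) (at x)" .
  moreover have "g (norm x) / norm x * (sgn x \<bullet> v) = g (norm x) / (norm x)\<^sup>2 * (x \<bullet> v)" for v
    using False by (simp add: sgn_div_norm power2_eq_square divide_inverse)
  ultimately have "((\<lambda>y. h (norm y) * y $ j) has_derivative
      (\<lambda>v. h (norm x) * v $ j + g (norm x) / (norm x)\<^sup>2 * (x \<bullet> v) * x $ j)) (at x)" by (simp only:)
  then show ?thesis
    by (rule has_derivative_transform_within_open[OF _ open_ball x]) (simp add: radial_partial_deriv)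
qed

lemma radial_second_partial_deriv:
  assumes "x \<in> ball 0 1"
  shows "partial_deriv i (partial_deriv j z) x =
    (if i = j then h (norm x) else 0) + g (norm x) / (norm x)\<^sup>2 * x $ i * x $ j"
  unfolding partial_deriv_def[of i] frechet_derivative_at[OF radial_partial_has_derivative[OF assms], symmetric]
  by (simp add: inner_axis) (simp add: axis_def)

lemma continuous_on_radial_second_partial_deriv:
  "continuous_on (ball 0 1) (partial_deriv i (partial_deriv j z))"
proof -
  have hc: "continuous_on (ball 0 1) (\<lambda>x :: real^'n. h (norm x))"
    by (intro continuous_on_compose2[OF h_cont] continuous_intros) auto
  have gc: "continuous_on (ball 0 1) (\<lambda>x :: real^'n. g (norm x))"
    by (intro continuous_on_compose2[OF g_cont] continuous_intros) auto
  then have gc': "\<forall>x\<in>ball 0 1. isCont (\<lambda>x :: real^'n. g (norm x)) x"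
    by (simp only: continuous_on_eq_continuous_at[OF open_ball])
  have q: "isCont (\<lambda>x. g (norm x) / (norm x)\<^sup>2 * x $ i * x $ j) x" if x: "x \<in> ball 0 1" for x :: "real^'n"
  proof (cases "x = 0")
    case True
    have "((\<lambda>x :: real^'n. g (norm x)) \<longlongrightarrow> g (norm (0 :: real^'n))) (at 0)"
      using gc' x True unfolding isCont_def by blast
    then have lim: "((\<lambda>x :: real^'n. norm (g (norm x))) \<longlongrightarrow> 0) (at 0)"
      using g_0 by (intro tendsto_norm_zero) simp
    \<comment> \<open>The factor \<open>y $ i * y $ j\<close> absorbs the singular denominator,
      leaving the bound \<open>\<bar>g (norm y)\<bar>\<close>, which tends to
      \<open>g 0 = 0\<close>.\<close>
    have "((\<lambda>x. g (norm x) / (norm x)\<^sup>2 * x $ i * x $ j) \<longlongrightarrow> 0) (at 0)"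
    proof (rule Lim_null_comparison[OF always_eventually lim], rule allI)
      fix y :: "real^'n"
      have "\<bar>y $ i\<bar> * \<bar>y $ j\<bar> \<le> norm y * norm y"
        by (intro mult_mono component_le_norm_cart) auto
      then have "\<bar>g (norm y)\<bar> * (\<bar>y $ i\<bar> * \<bar>y $ j\<bar>) \<le> \<bar>g (norm y)\<bar> * (norm y)\<^sup>2"
        by (intro mult_left_mono) (auto simp: power2_eq_square)
      then show "norm (g (norm y) / (norm y)\<^sup>2 * y $ i * y $ j) \<le> norm (g (norm y))"
        by (cases "y = 0") (auto simp: abs_mult divide_le_eq mult_ac)
    qed
    then show ?thesis using True by (simp add: isCont_def)
  next
    case False
    have "isCont (\<lambda>x. g (norm x)) x" using gc' x by blast
    then show ?thesis using False by (intro continuous_intros) auto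
  qed
  have "continuous_on (ball 0 1) (\<lambda>x. (if i = j then h (norm x) else 0) + g (norm x) / (norm x)\<^sup>2 * x $ i * x $ j)"
  proof (rule continuous_on_add)
    show "continuous_on (ball 0 1) (\<lambda>x :: real^'n. if i = j then h (norm x) else 0)"
      using hc by (cases "i = j") simp_all
  qed (intro continuous_at_imp_continuous_on ballI q)
  then show ?thesis
    by (rule continuous_on_eq) (simp add: radial_second_partial_deriv)
qed

lemma C2_on_radial: "C2_on (ball 0 1) z"
proof -
  have "C1_on (ball 0 1) (partial_deriv i z)" for i
    unfolding C1_on_def differentiable_def
    using radial_partial_has_derivative continuous_on_radial_second_partial_deriv by blast
  moreover have "C1_on (ball 0 1) z"
    unfolding C1_on_def
  proof (intro conjI ballI allI)
    fix x :: "real^'n" assume "x \<in> ball 0 1"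
    then show "z differentiable at x"
      using radial_has_derivative unfolding differentiable_def by blast
  next
    fix i
    show "continuous_on (ball 0 1) (partial_deriv i z)"
      using radial_partial_has_derivative
      by (intro continuous_at_imp_continuous_on ballI has_derivative_continuous) blast
  qed
  ultimately show ?thesis by (simp add: C2_on_def)
qed

lemma laplacian_radial:
  assumes "x \<in> ball 0 1"
  shows "laplacian z x = real CARD('n) * h (norm x) + g (norm x)"
proof -
  have "laplacian z x = (\<Sum>i\<in>UNIV. h (norm x) + g (norm x) / (norm x)\<^sup>2 * (x $ i * x $ i))"
    using assms by (simp add: laplacian_def radial_second_partial_deriv mult.assoc)
  also have "\<dots> = real CARD('n) * h (norm x) + g (norm x) / (norm x)\<^sup>2 * (x \<bullet> x)"
    by (simp only: sum.distrib sum_constant sum_distrib_left[symmetric] inner_vec_def inner_real_def)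
  finally show ?thesis by (cases "x = 0") (simp_all add: g_0 dot_square_norm)
qed

lemma lap_hess_matrix_radial:
  assumes "x \<in> ball 0 1"
  shows "lap_hess_matrix z x = (\<chi> i j.
    (if i = j then (real CARD('n) - 1) * h (norm x) + g (norm x) else 0)
      - g (norm x) / (norm x)\<^sup>2 * x $ i * x $ j)"
  using assms unfolding lap_hess_matrix_def hessian_def
  by (simp add: vec_eq_iff laplacian_radial radial_second_partial_deriv mat_def algebra_simps)

lemma radial_term: "g (norm x) / (norm x)\<^sup>2 * (x \<bullet> x) = g (norm (x :: real^'n))"
  by (cases "x = 0") (simp_all add: g_0 dot_square_norm)

lemma det_lap_hess_matrix_radial:
  assumes "x \<in> ball 0 1"
  shows "det (lap_hess_matrix z x) = ((real CARD('n) - 1) * h (norm x) + g (norm x)) ^ (CARD('n) - 1)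
    * ((real CARD('n) - 1) * h (norm x))"
  unfolding lap_hess_matrix_radial[OF assms] det_scaled_identity_minus_rank_one radial_term by simp

lemma positive_definite_lap_hess_matrix_radial:
  assumes x: "x \<in> ball 0 1" and "(real CARD('n) - 1) * h (norm x) > 0"
    "(real CARD('n) - 1) * h (norm x) + g (norm x) > 0"
  shows "positive_definite (lap_hess_matrix z x)"
  unfolding lap_hess_matrix_radial[OF x] using assms
  by (intro positive_definite_scaled_identity_minus_rank_one) (simp_all only: radial_term add_diff_cancel_right')

end

text \<open>The distance to the sphere is attained at some \<open>y\<close> with
  \<open>norm y = 1\<close>, so by the triangle inequality a point closer than \<open>1 - r0\<close>
  to the sphere has norm greater than \<open>r0\<close>.\<close>

lemma boundary_blow_up_radial:
  fixes z :: "real^'n \<Rightarrow> real"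
  assumes z: "\<And>x. x \<in> ball 0 1 \<Longrightarrow> z x = u (norm x)" and u: "filterlim u at_top (at_left 1)"
  shows "boundary_blow_up (ball 0 1) z"
  unfolding boundary_blow_up_def
proof
  fix M
  have "eventually (\<lambda>r. M < u r) (at_left 1)"
    using u by (simp add: filterlim_at_top_dense)
  then obtain r0 where r0: "r0 < 1" "\<And>r. r0 < r \<Longrightarrow> r < 1 \<Longrightarrow> M < u r"
    by (auto simp: eventually_at_left_field)
  have "M < z x" if x: "x \<in> ball 0 1" and d: "infdist x (frontier (ball 0 1)) < 1 - r0" for x
  proof -
    have "closed (sphere (0 :: real^'n) 1)" "sphere (0 :: real^'n) 1 \<noteq> {}" by auto
    then obtain y :: "real^'n" where y: "y \<in> sphere 0 1" "infdist x (sphere 0 1) = dist x y"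
      using infdist_attains_inf by metis
    then have "dist x y < 1 - r0" using d by simp
    moreover have "1 \<le> norm x + dist x y"
      using y(1) norm_triangle_ineq[of x "y - x"] by (simp add: dist_norm norm_minus_commute)
    ultimately show ?thesis using x r0(2)[of "norm x"] z[OF x] by simp
  qed
  then show "\<exists>\<delta>>0. \<forall>x\<in>ball 0 1. infdist x (frontier (ball 0 1)) < \<delta> \<longrightarrow> M < z x"
    using r0(1) by (intro exI[of _ "1 - r0"]) auto
qed

section \<open>Solutions with a prescribed central value\<close>

context radial_problem
begin

lemma radial_solution_with_center_value:
  assumes N: "N = CARD('n::finite)" and u0: "u\<^sub>0 > b"
    and p: "p \<in> class_P_infinity N" and c: "c > 0"
    and Kp: "\<forall>\<^sub>F r in at_left 1. c * p (1 - r) \<le> K r"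
  obtains z :: "real^'n \<Rightarrow> real" where "z \<in> extensional (ball 0 1)" "radial_solution K f z"
    "Nm1_convex_on (ball 0 1) z" "z 0 = u\<^sub>0"
proof -
  obtain u where u: "continuous_on {0..<1} u" "\<And>r. r \<in> {0..<1} \<Longrightarrow> u r \<ge> u\<^sub>0"
    "\<And>r. r \<in> {0..<1} \<Longrightarrow> u r = radial_map u\<^sub>0 u r"
    using radial_map_fixed_point[OF u0] by metis
  have up: "u r > 0" if "r \<in> {0..<1}" for r using u(2)[OF that] u0 b_pos by linarith
  interpret radial_source N "source u" by (rule radial_source_source[OF u(1) up])
  \<comment> \<open>This is \<open>r h'\<close> by \<open>slope_has_real_derivative\<close>, so that
    \<open>(N - 1) * h + g\<close> is the eigenvalue \<open>\<alpha>\<close>.\<close>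
  define g where "g r = \<alpha> r - (real N - 1) * h r" for r
  \<comment> \<open>The restriction gives a fixed default outside the ball, so that solutions are
    counted as functions on the ball only.\<close>
  define z :: "real^'n \<Rightarrow> real" where "z = restrict (\<lambda>x. u (norm x)) (ball 0 1)"
  have z: "z x = u (norm x)" if "x \<in> ball 0 1" for x using that by (simp add: z_def)
  have u': "(u has_real_derivative r * h r) (at r within {0..<1})" if r: "r \<in> {0..<1}" for r
    by (rule has_field_derivative_transform_within
        [OF radial_map_has_real_derivative[OF u(1) up r, of "u\<^sub>0"] zero_less_one r])
      (simp_all add: u(3)[symmetric])
  interpret radial_function u h g z
  proof
    show "continuous_on {0..<1} g"
      unfolding g_def by (intro continuous_intros continuous_on_slope continuous_on_tangential)
  qed (use u' z continuous_on_slope slope_has_real_derivative tangential_0 in \<open>auto simp: g_def\<close>)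
  have nx: "norm x \<in> {0..<1}" if "x \<in> ball 0 1" for x :: "real^'n" using that by auto
  have N1: "real N - 1 > 0" using N_ge_2 by simp
  have conv: "Nm1_convex_on (ball 0 1) z"
    unfolding Nm1_convex_on_def
    using C2_on_radial slope_pos[OF nx] tangential_pos[OF nx] N1
    by (auto intro!: positive_definite_lap_hess_matrix_radial simp: N[symmetric] g_def)
  have "radial_solution K f z"
    unfolding radial_solution_def
  proof (intro conjI ballI C2_on_radial)
    show "\<exists>u. radial_profile u \<and> (\<forall>x\<in>ball 0 1. z x = u (norm x))"
    proof (rule exI[of _ u], intro conjI ballI z)
      show "radial_profile u"
        unfolding radial_profile_def
      proof (rule exI[of _ "\<lambda>r. r * h r"], rule exI[of _ "\<lambda>r. \<alpha> r - (real N - 2) * h r"], intro conjI ballI)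
        show "continuous_on {0..<1} (\<lambda>r. \<alpha> r - (real N - 2) * h r)"
          by (intro continuous_intros continuous_on_slope continuous_on_tangential)
      qed (use u' radial_derivative_has_real_derivative in auto)
    qed
    show "boundary_blow_up (ball 0 1) z"
    proof (rule boundary_blow_up_radial[of z u, OF z])
      show "filterlim u at_top (at_left 1)"
        using u u0 b_pos p c Kp u' by (intro radial_fixed_point_blow_up[of u "u\<^sub>0" p c] DERIV_within_unit) auto
    qed
    fix x :: "real^'n" assume x: "x \<in> ball 0 1"
    show "z x > 0" using z[OF x] up[OF nx[OF x]] by simp
    let ?r = "norm x"
    \<comment> \<open>The determinant is \<open>\<alpha> ^ (N - 1)\<close> times the single radial
      eigenvalue. Both factors are positive, so the root splits and \<open>radial_equation\<close>
      applies.\<close>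
    have "root (N - 1) (det (lap_hess_matrix z x)) = root (N - 1) (\<alpha> ?r ^ (N - 1) * ((real N - 1) * h ?r))"
      unfolding det_lap_hess_matrix_radial[OF x] by (simp add: N[symmetric] g_def)
    also have "\<dots> = \<alpha> ?r * root (N - 1) ((real N - 1) * h ?r)"
      using N_ge_2 tangential_pos[OF nx[OF x]] by (simp add: real_root_mult real_root_power_cancel)
    also have "root (N - 1) ((real N - 1) * h ?r) = ((real N - 1) * h ?r) powr (1 / (real N - 1))"
      using N_ge_2 N1 slope_pos[OF nx[OF x]] by (simp add: root_powr_inverse of_nat_diff)
    also have "\<alpha> ?r * \<dots> = K ?r * f (z x)"
      using radial_equation[OF nx[OF x]] z[OF x] by (simp add: mult.commute)
    finally show "root (CARD('n) - 1) (det (lap_hess_matrix z x)) = K ?r * f (z x)"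
      by (simp add: N)
  qed
  moreover have "z 0 = u\<^sub>0" using z[of 0] u(3)[of 0] by (simp add: radial_map_0)
  moreover have "z \<in> extensional (ball 0 1)" by (simp add: z_def)
  ultimately show thesis using that conv by blast
qed

end

theorem theorem4p1:
  fixes K f p :: "real \<Rightarrow> real" and a c d :: real and N :: nat
  assumes N_def: "N = CARD('n::finite)" and N_ge_2: "N \<ge> 2"
    and K_cont: "continuous_on {0..<1} K" and K_pos: "\<And>r. r \<in> {0..<1} \<Longrightarrow> K r > 0"
    and f_pos: "\<And>s. s > 0 \<Longrightarrow> f s > 0"
    and f_mono: "mono_on {0<..} f"
    and f_lipschitz: "local_lipschitz (UNIV :: real set) {0<..} (\<lambda>_. f)"
    and F_div: "integral_diverges_at_top (\<lambda>\<tau>. F_fun f \<tau> powr (- ((real N - 1) / (2 * real N - 1))))"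
    and p: "p \<in> class_P_infinity N" and c_pos: "c > 0" and d_pos: "d > 0"
    and K_bounds: "\<forall>\<^sub>F r in at_left 1. c * p (1 - r) \<le> K r \<and> K r \<le> d * p (1 - r)"
    and a_pos: "a > 0"
    and H_lim: "\<exists>L. ((\<lambda>\<tau>. ereal (H_fun N f a \<tau>)) \<longlongrightarrow> L) at_top"
  shows "infinite {z :: real^'n \<Rightarrow> real. z \<in> extensional (ball 0 1) \<and>
           radial_solution K f z \<and> Nm1_convex_on (ball 0 1) z}"
proof -
  have f_cont: "continuous_on {0<..} f"
    using local_lipschitz_continuous_on[OF f_lipschitz] by simp
  obtain b where "b > 0" and "filterlim (\<lambda>t::real. LBINT \<tau>=ereal b..ereal t.
      F_fun f \<tau> powr (- ((real N - 1) / (2 * real N - 1)))) at_top at_top"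
    using F_div unfolding integral_diverges_at_top_def by blast
  then interpret radial_problem N K f b
    using N_ge_2 K_cont K_pos f_pos f_mono f_cont by unfold_locales auto
  have lower: "\<forall>\<^sub>F r in at_left 1. c * p (1 - r) \<le> K r"
    using K_bounds by (rule eventually_mono) simp
  let ?S = "{z :: real^'n \<Rightarrow> real. z \<in> extensional (ball 0 1) \<and>
           radial_solution K f z \<and> Nm1_convex_on (ball 0 1) z}"
  \<comment> \<open>Evaluation at the origin maps the solution set onto a superset of the infinite
    ray \<open>{b<..}\<close>, so the solution set cannot be finite.\<close>
  have "{b<..} \<subseteq> (\<lambda>z. z 0) ` ?S"
  proof
    fix s assume "s \<in> {b<..}"
    then obtain z :: "real^'n \<Rightarrow> real" where "z \<in> ?S" "z 0 = s"
      using radial_solution_with_center_value[OF N_def _ p c_pos lower, of s] by auto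
    then show "s \<in> (\<lambda>z. z 0) ` ?S" by blast
  qed
  then show ?thesis
    using infinite_Ioi[of b] finite_surj by blast
qed

end
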